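(* Let $N\ge3$ and $\zeta^N=-1$. The function $R(\zeta)$, defined near the maximal Argyres-Douglas point $u_0=1$, $u_1=\dots=u_{N-2}=0$, is the analytic continuation in the modulus $v=1-u_0$ of the function $Q(\xi)$ with $\xi=\zeta$ (so $\xi^N=-1$, the small branch points), defined near the $\mathbb Z_{2N}$-symmetric point $u_0=u_1=\dots=u_{N-2}=0$. (The continuation is taken along $v$ from $1$ towards $0$ on the real segment, with $u_1,\dots,u_{N-2}$ sufficiently small depending on $v$.)
   Context: The Seiberg-Witten curve for gauge group $SU(N)$ without hypermultiplets (strong coupling scale $\Lambda=1$) is $y^2=A(x)^2-1$ with $A(x)=x^N-\sum_{n=0}^{N-2}u_nx^n$, and the Seiberg-Witten differential is $\lambda=xA'(x)\,dx/y$. Definition of $Q(\xi)$ near $u_0=\dots=u_{N-2}=0$: for $\xi^{2N}=1$ and all $u_n$ small, the curve has a unique branch point $x_\xi$ near $\xi$ (with $x_\xi=\xi$ when all $u_n=0$), and $i\pi Q(\xi)=\int_0^{x_\xi}\lambda$ along a small deformation of the segment $[0,\xi]$, with $y$ continued along the path from its value $y(0)=-i\sqrt{1-u_0^2}$ at $x=0$ (square root near $1$). Definition of $R(\zeta)$ near the Argyres-Douglas point: put $v=1-u_0$, $x=v^{1/N}z$, $u_n=v^{1-\frac nN}v_n$ for $1\le n\le N-2$ (powers of $v$ positive for $v>0$), and $P(z)=z^N-\sum_{n=1}^{N-2}v_nz^n+1$, so that $y^2=vP(z)(vP(z)-2)$. For $0<|v|$ and $|v_n|$ small and $\zeta^N=-1$,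 $P$ has a unique root $z_\zeta$ near $\zeta$, and $i\pi R(\zeta)=\int_0^{z_\zeta}\lambda$ along a small deformation of the segment $[0,\zeta]$ in the $z$-plane, with $y$ continued along the path from its value $y(0)=-i\sqrt{v(2-v)}$ at $z=0$ (square root positive for $0<v<2$). In both cases replacing the starting point $(0,y(0))$ by $(0,-y(0))$ reverses the overall sign; compatible choices are made here. *)

theory Defs
  imports "HOL-Complex_Analysis.Complex_Analysis" "HOL-Computational_Algebra.Polynomial"
begin

text \<open>A point of the moduli space is \<open>u :: nat \<Rightarrow> complex\<close>, of which only the coordinates
  \<open>u 0, \<dots>, u (N - 2)\<close> are ever used.\<close>

definition SW_poly :: "nat \<Rightarrow> (nat \<Rightarrow> complex) \<Rightarrow> complex poly" where
  "SW_poly N u = monom 1 N - (\<Sum>n\<le>N - 2. monom (u n) n)"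

definition SW_branch_point :: "nat \<Rightarrow> (nat \<Rightarrow> complex) \<Rightarrow> complex \<Rightarrow> bool" where
  "SW_branch_point N u x \<longleftrightarrow> odd (order x ((SW_poly N u)\<^sup>2 - 1))"

text \<open>\<open>Y\<close> is the continuation of \<open>y\<close> along \<open>\<gamma>\<close>. Only the end point of \<open>\<gamma>\<close> may be a zero of
  \<open>y\<close>, so \<open>Y\<close> is determined by \<open>Y 0\<close>.\<close>

definition SW_lift ::
  "nat \<Rightarrow> (nat \<Rightarrow> complex) \<Rightarrow> (real \<Rightarrow> complex) \<Rightarrow> (real \<Rightarrow> complex) \<Rightarrow> bool" where
  "SW_lift N u \<gamma> Y \<longleftrightarrow>
     continuous_on {0..1} Y \<and>
     (\<forall>t\<in>{0..1}. (Y t)\<^sup>2 = (poly (SW_poly N u) (\<gamma> t))\<^sup>2 - 1) \<and>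
     (\<forall>t\<in>{0..<1}. Y t \<noteq> 0)"

text \<open>\<open>I\<close> is the integral of \<open>\<lambda> = x A'(x) dx / y\<close> along the lifted path \<open>(\<gamma>, Y)\<close>. It is written
  out as in \<open>has_contour_integral\<close>, because \<open>y\<close> is a function on the path and not of \<open>x\<close>.\<close>

definition SW_integral ::
  "nat \<Rightarrow> (nat \<Rightarrow> complex) \<Rightarrow> (real \<Rightarrow> complex) \<Rightarrow> (real \<Rightarrow> complex) \<Rightarrow> complex \<Rightarrow> bool" where
  "SW_integral N u \<gamma> Y I \<longleftrightarrow>
     ((\<lambda>t. \<gamma> t * poly (pderiv (SW_poly N u)) (\<gamma> t) / Y t
           * vector_derivative \<gamma> (at t within {0..1})) has_integral I) {0..1}"

text \<open>A small deformation of the segment from \<open>0\<close> to \<open>\<xi>\<close> is a path that stays in a tube of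
  small radius \<open>\<rho>\<close> around the segment.\<close>

definition tube :: "real \<Rightarrow> complex \<Rightarrow> complex set" where
  "tube \<rho> \<xi> = (\<Union>s\<in>closed_segment 0 \<xi>. ball s \<rho>)"

definition near_segment :: "real \<Rightarrow> complex \<Rightarrow> complex \<Rightarrow> (real \<Rightarrow> complex) \<Rightarrow> bool" where
  "near_segment \<rho> \<xi> b \<gamma> \<longleftrightarrow>
     valid_path \<gamma> \<and> pathstart \<gamma> = 0 \<and> pathfinish \<gamma> = b \<and> path_image \<gamma> \<subseteq> tube \<rho> \<xi>"

definition Q_value :: "nat \<Rightarrow> real \<Rightarrow> complex \<Rightarrow> (nat \<Rightarrow> complex) \<Rightarrow> complex \<Rightarrow> bool" where
  "Q_value N \<rho> \<xi> u q \<longleftrightarrow>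
     (\<exists>b \<gamma> Y.
        {x \<in> ball \<xi> \<rho>. SW_branch_point N u x} = {b} \<and>
        near_segment \<rho> \<xi> b \<gamma> \<and>
        SW_lift N u \<gamma> Y \<and> Y 0 = - \<i> * csqrt (1 - (u 0)\<^sup>2) \<and>
        SW_integral N u \<gamma> Y (\<i> * of_real pi * q))"

definition polydisc :: "nat \<Rightarrow> (nat \<Rightarrow> complex) \<Rightarrow> real \<Rightarrow> (nat \<Rightarrow> complex) set" where
  "polydisc N c r = {u. \<forall>n\<le>N - 2. dist (c n) (u n) < r}"

text \<open>\<open>Q\<close> is the function \<open>Q(\<xi>)\<close> near the origin: for every small tube and all \<open>u\<close> small
  (depending on the tube), admissible paths exist, and every one of them gives the value
  \<open>Q u\<close>. The germ of \<open>Q\<close> at the origin is determined by this.\<close>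

definition is_Q :: "nat \<Rightarrow> complex \<Rightarrow> ((nat \<Rightarrow> complex) \<Rightarrow> complex) \<Rightarrow> bool" where
  "is_Q N \<xi> Q \<longleftrightarrow>
     (\<exists>\<rho>\<^sub>0>0. \<forall>\<rho>\<in>{0<..\<rho>\<^sub>0}. \<exists>\<epsilon>>0. \<forall>u\<in>polydisc N (\<lambda>_. 0) \<epsilon>. \<forall>q.
        Q_value N \<rho> \<xi> u q \<longleftrightarrow> q = Q u)"

text \<open>The coordinates \<open>(v, v\<^sub>1, \<dots>, v\<^sub>N\<^sub>-\<^sub>2)\<close> near the Argyres-Douglas point. All powers and
  square roots of \<open>v\<close> are principal values, which are the positive ones for \<open>v > 0\<close>.\<close>

definition AD_moduli :: "nat \<Rightarrow> complex \<Rightarrow> (nat \<Rightarrow> complex) \<Rightarrow> nat \<Rightarrow> complex" where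
  "AD_moduli N v w n =
     (if n = 0 then 1 - v else v powr (1 - of_nat n / of_nat N) * w n)"

definition AD_poly :: "nat \<Rightarrow> (nat \<Rightarrow> complex) \<Rightarrow> complex poly" where
  "AD_poly N w = monom 1 N - (\<Sum>n=1..N - 2. monom (w n) n) + 1"

text \<open>The path \<open>\<gamma>\<close> lies in the \<open>z\<close>-plane; \<open>\<lambda>\<close> is integrated along its image under
  \<open>x = v\<^sup>1\<^sup>/\<^sup>N z\<close>, where \<open>A(x) = v P(z) - 1\<close>.\<close>

definition R_value ::
  "nat \<Rightarrow> real \<Rightarrow> complex \<Rightarrow> complex \<Rightarrow> (nat \<Rightarrow> complex) \<Rightarrow> complex \<Rightarrow> bool" where
  "R_value N \<rho> \<zeta> v w r \<longleftrightarrow>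
     (\<exists>b \<gamma> Y.
        {z \<in> ball \<zeta> \<rho>. poly (AD_poly N w) z = 0} = {b} \<and>
        near_segment \<rho> \<zeta> b \<gamma> \<and>
        (let u = AD_moduli N v w; x = (\<lambda>t. v powr (1 / of_nat N) * \<gamma> t)
         in SW_lift N u x Y \<and> Y 0 = - \<i> * csqrt (v * (2 - v)) \<and>
            SW_integral N u x Y (\<i> * of_real pi * r)))"

definition is_R :: "nat \<Rightarrow> complex \<Rightarrow> (complex \<Rightarrow> (nat \<Rightarrow> complex) \<Rightarrow> complex) \<Rightarrow> bool" where
  "is_R N \<zeta> R \<longleftrightarrow>
     (\<exists>\<rho>\<^sub>0>0. \<forall>\<rho>\<in>{0<..\<rho>\<^sub>0}. \<exists>\<epsilon>>0. \<forall>v w.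
        0 < cmod v \<and> cmod v < \<epsilon> \<and> (\<forall>n\<in>{1..N - 2}. cmod (w n) < \<epsilon>) \<longrightarrow>
        (\<forall>r. R_value N \<rho> \<zeta> v w r \<longleftrightarrow> r = R v w))"

text \<open>Complex (Frechet) differentiability in the \<open>N - 1\<close> variables at every point of \<open>W\<close>, for
  \<open>W\<close> open in these variables; in particular \<open>F\<close> depends on no other coordinate.\<close>

definition moduli_holomorphic_on ::
  "nat \<Rightarrow> ((nat \<Rightarrow> complex) \<Rightarrow> complex) \<Rightarrow> (nat \<Rightarrow> complex) set \<Rightarrow> bool" where
  "moduli_holomorphic_on N F W \<longleftrightarrow>
     (\<forall>u\<in>W. \<exists>D. \<forall>e>0. \<exists>d>0. \<forall>w \<in> W \<inter> polydisc N u d.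
        cmod (F w - F u - (\<Sum>n\<le>N - 2. D n * (w n - u n)))
          \<le> e * (\<Sum>n\<le>N - 2. cmod (w n - u n)))"

text \<open>The continuation runs along the points \<open>u\<^sub>0 = 1 - v\<close>, \<open>u\<^sub>1 = \<dots> = u\<^sub>N\<^sub>-\<^sub>2 = 0\<close> with
  \<open>0 < v \<le> 1\<close>, from \<open>v = 1\<close> towards \<open>v = 0\<close>. The function \<open>F\<close> is holomorphic on a connected
  open neighbourhood of these points, whose size \<open>r v\<close> may shrink with \<open>v\<close>. The germ of \<open>F\<close> at
  \<open>v = 1\<close> is \<open>Q\<close>, and its germ at every small \<open>v > 0\<close> is \<open>R\<close>.\<close>

abbreviation real_slice :: "real \<Rightarrow> nat \<Rightarrow> complex" where
  "real_slice v \<equiv> (\<lambda>n. if n = 0 then of_real (1 - v) else 0)"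

definition is_continuation ::
  "nat \<Rightarrow> ((nat \<Rightarrow> complex) \<Rightarrow> complex) \<Rightarrow> (complex \<Rightarrow> (nat \<Rightarrow> complex) \<Rightarrow> complex) \<Rightarrow> bool" where
  "is_continuation N Q R \<longleftrightarrow>
     (\<exists>r F.
        (\<forall>v\<in>{0<..1}. 0 < r v) \<and>
        moduli_holomorphic_on N F (\<Union>v\<in>{0<..1}. polydisc N (real_slice v) (r v)) \<and>
        (\<forall>u\<in>polydisc N (real_slice 1) (r 1). F u = Q u) \<and>
        (\<exists>\<epsilon>\<in>{0<..1}. \<forall>v\<in>{0<..<\<epsilon>}. \<forall>v' w.
           AD_moduli N v' w \<in> polydisc N (real_slice v) (r v) \<longrightarrow>
           F (AD_moduli N v' w) = R v' w))"

end

theory Submission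
  imports Defs "HOL-Computational_Algebra.Fundamental_Theorem_Algebra"
begin

text \<open>In the Argyres-Douglas coordinates \<open>(v, v\<^sub>1, \<dots>, v\<^sub>N\<^sub>-\<^sub>2)\<close> the curve is \<open>y\<^sup>2 = v P (v P - 2)\<close>, and on
  a thin tube around the segment \<open>[0, \<zeta>]\<close> the only zero of \<open>y\<close> is the simple root \<open>b\<close> of \<open>P\<close>
  near \<open>\<zeta>\<close>, as long as \<open>\<bar>v\<bar> < 4/3\<close> and the \<open>v\<^sub>n\<close> are small. So the same tube serves both points
  \<open>v = 1\<close> and \<open>v \<rightarrow> 0\<close>. Uniformizing the branch point by \<open>z = b (1 - \<tau>\<^sup>2)\<close> turns \<open>\<lambda>\<close> into a
  holomorphic form, hence every admissible path gives the integral of one explicit function over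
  \<open>[0, 1]\<close>. That integral is \<open>R\<close>, and after the substitution \<open>v = 1 - u\<^sub>0\<close>,
  \<open>v\<^sub>n = u\<^sub>n / v\<^sup>1\<^sup>-\<^sup>n\<^sup>/\<^sup>N\<close> it is also \<open>Q\<close>. It is bounded and holomorphic in each variable, so
  Frechet differentiable by Osgood's argument.\<close>

section \<open>Parameter integrals, square-root singularities and Osgood's lemma\<close>

lemma Cauchy_Taylor_first_order:
  assumes hol: "f holomorphic_on ball a (2 * r)" and r: "0 < r"
    and bd: "\<And>z. z \<in> ball a (2 * r) \<Longrightarrow> cmod (f z) \<le> B"
    and z: "z \<in> ball a r"
  shows "cmod (deriv f z) \<le> 2 * B / r"
    and "cmod (f z - f a - deriv f a * (z - a)) \<le> 8 * B / r\<^sup>2 * (cmod (z - a))\<^sup>2"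
proof -
  have D: "cmod ((deriv ^^ n) f x) \<le> fact n * B / (r / 2) ^ n" if x: "x \<in> ball a r" for n x
  proof -
    have sub: "cball x (r / 2) \<subseteq> ball a (2 * r)"
    proof
      fix y assume "y \<in> cball x (r / 2)"
      then have "dist a y < 2 * r"
        using x r dist_triangle[of a y x] by auto
      then show "y \<in> ball a (2 * r)" by simp
    qed
    show ?thesis
    proof (rule Cauchy_inequality)
      show "f holomorphic_on ball x (r / 2)"
        using hol sub by (meson ball_subset_cball holomorphic_on_subset order_trans)
      show "continuous_on (cball x (r / 2)) f"
        using hol sub by (meson holomorphic_on_imp_continuous_on holomorphic_on_subset)
      show "cmod (f y) \<le> B" if "cmod (x - y) = r / 2" for y
        using bd sub that by (auto simp: dist_norm subset_iff)
    qed (use r in auto)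
  qed
  show "cmod (deriv f z) \<le> 2 * B / r"
    using D[OF z, of 1] by (simp add: field_simps)
  have hol': "(deriv ^^ n) f holomorphic_on ball a r" for n
    by (rule holomorphic_higher_deriv) (use hol r in \<open>auto intro: holomorphic_on_subset\<close>)
  have "cmod ((deriv ^^ 0) f z - (\<Sum>i\<le>1. (deriv ^^ i) f a * (z - a) ^ i / fact i))
      \<le> 8 * B / r\<^sup>2 * cmod (z - a) ^ Suc 1 / fact 1"
  proof (rule complex_Taylor)
    fix i x assume "x \<in> ball a r"
    then show "((deriv ^^ i) f has_field_derivative (deriv ^^ Suc i) f x) (at x within ball a r)"
      using holomorphic_derivI[OF hol'] by simp
  next
    fix x assume "x \<in> ball a r"
    then show "cmod ((deriv ^^ Suc 1) f x) \<le> 8 * B / r\<^sup>2"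
      using D[of x "Suc 1"] r by (simp add: field_simps power2_eq_square)
  qed (use z r in auto)
  then show "cmod (f z - f a - deriv f a * (z - a)) \<le> 8 * B / r\<^sup>2 * (cmod (z - a))\<^sup>2"
    by (simp add: power2_eq_square algebra_simps)
qed

lemma holomorphic_on_integral:
  fixes f :: "complex \<Rightarrow> real \<Rightarrow> complex"
  assumes U: "open U"
    and hol: "\<And>t. t \<in> {0..1} \<Longrightarrow> (\<lambda>x. f x t) holomorphic_on U"
    and int: "\<And>x. x \<in> U \<Longrightarrow> f x integrable_on {0..1}"
    and bd: "\<And>x t. x \<in> U \<Longrightarrow> t \<in> {0..1} \<Longrightarrow> cmod (f x t) \<le> B"
  shows "(\<lambda>x. integral {0..1} (f x)) holomorphic_on U"
  unfolding holomorphic_on_open[OF U]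
proof
  fix a assume a: "a \<in> U"
  then obtain R where R: "R > 0" "ball a R \<subseteq> U" using U openE by blast
  define r where "r = R / 2"
  have r: "r > 0" "ball a (2 * r) \<subseteq> U" using R by (auto simp: r_def)
  define g where "g t = deriv (\<lambda>x. f x t) a" for t
  define C where "C = 8 * B / r\<^sup>2"
  have B0: "B \<ge> 0" by (rule order_trans[OF norm_ge_zero bd[OF a, of 0]]) simp
  then have C0: "C \<ge> 0" by (simp add: C_def)
  have T: "cmod (f x t - f a t - g t * (x - a)) \<le> C * (cmod (x - a))\<^sup>2"
    if "x \<in> ball a r" "t \<in> {0..1}" for x t
    unfolding g_def C_def
    by (rule Cauchy_Taylor_first_order(2))
       (use that r bd hol[OF that(2)] in \<open>auto intro: holomorphic_on_subset\<close>)
  have gint: "g integrable_on {0..1}"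
    unfolding box_real[symmetric]
  proof (rule integrable_uniform_limit)
    fix e :: real assume e: "e > 0"
    define s where "s = min (r / 2) (e / (C + 1))"
    have s: "s > 0" "s < r" "C * s \<le> e"
    proof -
      show "s > 0" "s < r" using r e C0 by (auto simp: s_def)
      have "C * s \<le> (C + 1) * (e / (C + 1))"
        using C0 e r by (intro mult_mono) (auto simp: s_def)
      then show "C * s \<le> e" using C0 by simp
    qed
    define h :: complex where "h = of_real s"
    have h: "h \<noteq> 0" "cmod h = s" using s by (auto simp: h_def)
    have xa: "a + h \<in> ball a r" using h s by (simp add: dist_norm)
    show "\<exists>q. (\<forall>t\<in>cbox 0 1. norm (g t - q t) \<le> e) \<and> q integrable_on cbox 0 1"
    proof (intro exI conjI ballI)
      show "(\<lambda>t. (f (a + h) t - f a t) * inverse h) integrable_on cbox 0 1"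
        using int[OF a] int[of "a + h"] xa r
        by (intro integrable_on_mult_left integrable_diff) (auto simp: subset_iff)
      fix t :: real assume "t \<in> cbox 0 1"
      then have "cmod (f (a + h) t - f a t - g t * h) \<le> C * s\<^sup>2"
        using T[OF xa, of t] h by simp
      moreover have "g t - (f (a + h) t - f a t) * inverse h = - (f (a + h) t - f a t - g t * h) / h"
        using h by (simp add: field_simps)
      ultimately have "norm (g t - (f (a + h) t - f a t) * inverse h) \<le> C * s\<^sup>2 / s"
        using s h by (simp add: norm_divide norm_minus_commute divide_right_mono)
      also have "\<dots> \<le> e" using s by (simp add: power2_eq_square)
      finally show "norm (g t - (f (a + h) t - f a t) * inverse h) \<le> e" .
    qed
  qed
  have "((\<lambda>x. integral {0..1} (f x)) has_field_derivative integral {0..1} g) (at a)"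
    unfolding has_field_derivative_def has_derivative_at_alt
  proof (intro conjI allI impI bounded_linear_mult_right)
    fix e :: real assume e: "e > 0"
    define d where "d = min r (e / (C + 1))"
    have d: "d > 0" using r e C0 by (auto simp: d_def)
    show "\<exists>d>0. \<forall>y. norm (y - a) < d \<longrightarrow>
        norm (integral {0..1} (f y) - integral {0..1} (f a) - integral {0..1} g * (y - a))
        \<le> e * norm (y - a)"
    proof (intro exI conjI allI impI)
      show "d > 0" by fact
      fix y assume y: "norm (y - a) < d"
      then have yb: "y \<in> ball a r" by (simp add: d_def dist_norm norm_minus_commute)
      then have yU: "y \<in> U" using r by (auto simp: subset_iff)
      have I: "((\<lambda>t. f y t - f a t - g t * (y - a)) has_integral
          (integral {0..1} (f y) - integral {0..1} (f a) - integral {0..1} g * (y - a))) {0..1}"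
        by (intro has_integral_diff has_integral_mult_left integrable_integral int yU a gint)
      have "norm (integral {0..1} (f y) - integral {0..1} (f a) - integral {0..1} g * (y - a))
          \<le> C * (cmod (y - a))\<^sup>2 * measure lborel {0..1::real}"
        by (rule has_integral_bound_real[OF _ _ I, of _ "{}"]) (use T[OF yb] C0 in auto)
      also have "\<dots> = C * cmod (y - a) * cmod (y - a)" by (simp add: power2_eq_square)
      also have "\<dots> \<le> e * cmod (y - a)"
      proof (rule mult_right_mono)
        have "C * cmod (y - a) \<le> (C + 1) * (e / (C + 1))"
          using C0 e y by (intro mult_mono) (auto simp: d_def)
        then show "C * cmod (y - a) \<le> e" using C0 by simp
      qed simp
      finally show "norm (integral {0..1} (f y) - integral {0..1} (f a) - integral {0..1} g * (y - a))
          \<le> e * norm (y - a)" .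
    qed
  qed
  then show "\<exists>f'. ((\<lambda>x. integral {0..1} (f x)) has_field_derivative f') (at a)" by blast
qed

lemma has_vector_derivative_of_square:
  fixes T g :: "real \<Rightarrow> complex"
  assumes T: "isCont T t" "T t \<noteq> 0"
    and sq: "\<forall>\<^sub>F s in at t. (T s)\<^sup>2 = g s" "(T t)\<^sup>2 = g t"
    and g: "(g has_vector_derivative g') (at t)"
  shows "(T has_vector_derivative g' / (2 * T t)) (at t)"
proof -
  have "isCont (\<lambda>s. Re (T s / T t)) t" using T by (simp add: isCont_Re isCont_divide)
  then have "((\<lambda>s. Re (T s / T t)) \<longlongrightarrow> Re (T t / T t)) (at t)" by (rule isContD)
  then have pos: "\<forall>\<^sub>F s in at t. Re (T s / T t) > 0"
    using T by (intro order_tendstoD(1)[of _ 1]) auto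
  have eq: "\<forall>\<^sub>F s in at t. T t * csqrt (g s / g t) = T s"
    using pos sq(1)
  proof eventually_elim
    case (elim s)
    have "g s / g t = (T s / T t)\<^sup>2" by (simp add: power_divide sq(2) elim(2))
    then have "csqrt (g s / g t) = T s / T t" using elim by (simp add: csqrt_square)
    then show ?case using T by simp
  qed
  have g0: "g t \<noteq> 0" using sq(2) T by auto
  have "((\<lambda>z. T t * csqrt (z / g t)) has_field_derivative T t * (inverse (g t) / 2)) (at (g t))"
    using g0 by (auto intro!: derivative_eq_intros simp: field_simps)
  from field_vector_diff_chain_at[OF g this]
  have "((\<lambda>s. T t * csqrt (g s / g t)) has_vector_derivative g' * (T t * (inverse (g t) / 2))) (at t)"
    by (simp add: o_def)
  then have "(T has_vector_derivative g' * (T t * (inverse (g t) / 2))) (at t)"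
    unfolding has_vector_derivative_def
    by (rule has_derivative_transform_eventually[OF _ eq]) (use g0 in auto)
  moreover have "g' * (T t * (inverse (g t) / 2)) = g' / (2 * T t)"
    using T sq(2)[symmetric] by (simp add: field_simps power2_eq_square)
  ultimately show ?thesis by metis
qed

text \<open>In the variable \<open>\<tau> = \<surd>(1 - s)\<close> the form \<open>L(s) ds / T\<close> is holomorphic on a starlike domain, so
  it has a primitive there. A path may wind around \<open>s = 1\<close> any number of times: its lift to the
  \<open>\<tau>\<close>-domain still runs from \<open>1\<close> to \<open>0\<close>.\<close>

lemma sqrt_path_integral:
  fixes L :: "complex \<Rightarrow> complex"
  assumes D: "open D" "\<And>s r. s \<in> D \<Longrightarrow> r \<in> {0..1} \<Longrightarrow> 1 - of_real r * (1 - s) \<in> D"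
    and L: "L holomorphic_on D"
    and \<gamma>: "valid_path \<gamma>" "pathstart \<gamma> = 0" "pathfinish \<gamma> = 1" "path_image \<gamma> \<subseteq> D"
    and T: "continuous_on {0..1} T" "\<And>t. t \<in> {0..1} \<Longrightarrow> (T t)\<^sup>2 = c * (1 - \<gamma> t)"
      "\<And>t. t \<in> {0..<1} \<Longrightarrow> T t \<noteq> 0"
  shows "((\<lambda>t. L (\<gamma> t) / T t * vector_derivative \<gamma> (at t within {0..1})) has_integral
           2 / T 0 * integral {0..1} (\<lambda>\<sigma>. L (1 - of_real (\<sigma>\<^sup>2)))) {0..1}"
proof -
  define E where "E = {\<tau>. 1 - \<tau>\<^sup>2 \<in> D}"
  define g where "g \<tau> = L (1 - \<tau>\<^sup>2)" for \<tau>
  have T0: "T 0 \<noteq> 0" and c: "(T 0)\<^sup>2 = c"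
    using T(2)[of 0] T(3)[of 0] \<gamma> by (auto simp: pathstart_def)
  have end1: "\<gamma> 1 = 1" "\<gamma> 0 = 0" using \<gamma> by (auto simp: pathfinish_def pathstart_def)
  have T1: "T 1 = 0" using T(2)[of 1] end1 by simp
  have \<gamma>D: "\<gamma> t \<in> D" if "t \<in> {0..1}" for t using \<gamma>(4) that by (auto simp: path_image_def)
  have "E = (\<lambda>\<tau>. 1 - \<tau>\<^sup>2) -` D" by (auto simp: E_def)
  then have oE: "open E"
    using D(1) by (auto intro!: open_vimage continuous_intros)
  have scale: "of_real r * \<tau> \<in> E" if "\<tau> \<in> E" "r \<in> {0..1}" for \<tau> r
    using D(2)[of "1 - \<tau>\<^sup>2" "r\<^sup>2"] that by (auto simp: E_def power_mult_distrib abs_square_le_1)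
  have "0 \<in> E" using \<gamma>D[of 1] end1 by (simp add: E_def)
  moreover have "closed_segment 0 \<tau> \<subseteq> E" if "\<tau> \<in> E" for \<tau>
    using scale[OF that] by (auto simp: closed_segment_def scaleR_conv_of_real)
  ultimately have sE: "starlike E" unfolding starlike_def by blast
  have gE: "g holomorphic_on E"
    unfolding g_def
    by (rule holomorphic_on_compose_gen[OF _ L, unfolded o_def]) (auto simp: E_def intro!: holomorphic_intros)
  obtain \<Phi> where \<Phi>: "\<And>\<tau>. \<tau> \<in> E \<Longrightarrow> (\<Phi> has_field_derivative g \<tau>) (at \<tau>)"
    using holomorphic_starlike_primitive[OF holomorphic_on_imp_continuous_on[OF gE] sE oE, of "{}"]
      gE oE holomorphic_on_imp_differentiable_at by blast
  have rE: "of_real \<sigma> \<in> E" if "\<sigma> \<in> {0..1}" for \<sigma>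
    using scale[of 1 \<sigma>] that \<gamma>D[of 0] end1 by (simp add: E_def)
  have "((\<lambda>\<sigma>. g (of_real \<sigma>)) has_integral \<Phi> (of_real 1) - \<Phi> (of_real 0)) {0..1}"
  proof (rule fundamental_theorem_of_calculus)
    fix \<sigma> :: real assume "\<sigma> \<in> {0..1}"
    then show "((\<lambda>\<sigma>. \<Phi> (of_real \<sigma>)) has_vector_derivative g (of_real \<sigma>)) (at \<sigma> within {0..1})"
      using \<Phi>[OF rE] has_vector_derivative_real_field has_vector_derivative_at_within by blast
  qed simp
  then have J: "\<Phi> 1 - \<Phi> 0 = integral {0..1} (\<lambda>\<sigma>. L (1 - of_real (\<sigma>\<^sup>2)))"
    by (simp add: g_def integral_unique)
  define \<tau> where "\<tau> t = T t / T 0" for t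
  have \<tau>E: "\<tau> t \<in> E" and \<tau>sq: "(\<tau> t)\<^sup>2 = 1 - \<gamma> t" if "t \<in> {0..1}" for t
  proof -
    show "(\<tau> t)\<^sup>2 = 1 - \<gamma> t" using T(2)[OF that] c[symmetric] T0 by (simp add: \<tau>_def power_divide)
    then show "\<tau> t \<in> E" using \<gamma>D[OF that] by (simp add: E_def)
  qed
  obtain S where S: "finite S" "\<And>t. t \<in> {0..1} - S \<Longrightarrow> \<gamma> differentiable at t"
    using \<gamma>(1) by (auto simp: valid_path_def piecewise_C1_differentiable_on_def C1_differentiable_on_eq)
  have "((\<lambda>t. L (\<gamma> t) / T t * vector_derivative \<gamma> (at t within {0..1})) has_integral
          (- 2 / T 0) * \<Phi> (\<tau> 1) - (- 2 / T 0) * \<Phi> (\<tau> 0)) {0..1}"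
  proof (rule fundamental_theorem_of_calculus_interior_strong[OF S(1)])
    show "continuous_on {0..1} (\<lambda>t. (- 2 / T 0) * \<Phi> (\<tau> t))"
    proof (intro continuous_intros)
      show "continuous_on {0..1} (\<lambda>t. \<Phi> (\<tau> t))"
      proof (rule continuous_on_compose2[of E \<Phi>])
        show "continuous_on E \<Phi>"
          using \<Phi> by (meson DERIV_isCont continuous_at_imp_continuous_on)
        show "continuous_on {0..1} \<tau>" unfolding \<tau>_def using T0 by (intro continuous_intros T) auto
      qed (use \<tau>E in auto)
    qed
    fix t assume t: "t \<in> {0<..<1} - S"
    then have t': "t \<in> {0<..<1}" "t \<in> {0..1}" by auto
    define \<gamma>' where "\<gamma>' = vector_derivative \<gamma> (at t)"
    have "(\<gamma> has_vector_derivative \<gamma>') (at t)"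
      using S(2)[of t] t by (simp add: \<gamma>'_def vector_derivative_works)
    then have d: "((\<lambda>t. c * (1 - \<gamma> t)) has_vector_derivative - c * \<gamma>') (at t)"
      by (auto intro!: derivative_eq_intros)
    have ev: "\<forall>\<^sub>F s in at t. s \<in> {0<..<1}"
      using t' by (intro eventually_at_in_open') auto
    have "(T has_vector_derivative - c * \<gamma>' / (2 * T t)) (at t)"
    proof (rule has_vector_derivative_of_square[OF _ _ _ _ d])
      show "isCont T t"
        using T(1) t' by (simp add: continuous_on_interior)
      show "\<forall>\<^sub>F s in at t. (T s)\<^sup>2 = c * (1 - \<gamma> s)"
        using ev by eventually_elim (use T(2) in auto)
    qed (use T t in auto)
    then have "(\<tau> has_vector_derivative (- c * \<gamma>' / (2 * T t)) / T 0) (at t)"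
      unfolding \<tau>_def by (auto intro!: derivative_eq_intros)
    from field_vector_diff_chain_at[OF this \<Phi>[OF \<tau>E[OF t'(2)]]]
    have "((\<lambda>t. \<Phi> (\<tau> t)) has_vector_derivative (- c * \<gamma>' / (2 * T t)) / T 0 * g (\<tau> t)) (at t)"
      by (simp add: o_def)
    then have "((\<lambda>t. (- 2 / T 0) * \<Phi> (\<tau> t)) has_vector_derivative
        (- 2 / T 0) * ((- c * \<gamma>' / (2 * T t)) / T 0 * g (\<tau> t))) (at t)"
      by (rule has_vector_derivative_mult_right)
    moreover have "(- 2 / T 0) * ((- c * \<gamma>' / (2 * T t)) / T 0 * g (\<tau> t)) = L (\<gamma> t) / T t * \<gamma>'"
    proof -
      have "g (\<tau> t) = L (\<gamma> t)" using \<tau>sq[OF t'(2)] by (simp add: g_def)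
      then show ?thesis
        using T0 T(3)[of t] t' by (simp add: c[symmetric] field_simps power2_eq_square)
    qed
    moreover have "vector_derivative \<gamma> (at t within {0..1}) = \<gamma>'"
      unfolding \<gamma>'_def using t' S(2)[of t] t
      by (intro vector_derivative_at_within_ivl) (auto simp: vector_derivative_works[symmetric])
    ultimately show "((\<lambda>t. (- 2 / T 0) * \<Phi> (\<tau> t)) has_vector_derivative
        L (\<gamma> t) / T t * vector_derivative \<gamma> (at t within {0..1})) (at t)" by simp
  qed simp
  moreover have "\<tau> 1 = 0" "\<tau> 0 = 1" using T0 T1 by (auto simp: \<tau>_def)
  ultimately show ?thesis
    unfolding J[symmetric] by (simp add: algebra_simps diff_divide_distrib)
qed


lemma polydisc_upd:
  "w \<in> polydisc N u r \<Longrightarrow> x \<in> ball (u n) r \<Longrightarrow> w(n := x) \<in> polydisc N u r"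
  by (auto simp: polydisc_def)

lemma polydisc_mono: "w \<in> polydisc N u r \<Longrightarrow> r \<le> s \<Longrightarrow> w \<in> polydisc N u s"
  by (force simp: polydisc_def)

lemma separately_holomorphic_telescope:
  fixes F :: "(nat \<Rightarrow> complex) \<Rightarrow> complex" and w w' :: "nat \<Rightarrow> complex"
  defines "X \<equiv> \<lambda>m i. if i < m then w i else w' i"
  assumes dep: "\<And>w w'. (\<And>n. n \<le> M \<Longrightarrow> w n = w' n) \<Longrightarrow> F w = F w'"
  shows "F w - F w' = (\<Sum>m\<le>M. F ((X m)(m := w m)) - F ((X m)(m := w' m)))"
proof -
  have "F w = F (X (Suc M))" by (rule dep) (auto simp: X_def)
  moreover have "F w' = F (X 0)" by (rule dep) (auto simp: X_def)
  moreover have "X (Suc m) = (X m)(m := w m)" for m by (auto simp: X_def)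
  moreover have "X m = (X m)(m := w' m)" for m by (auto simp: X_def)
  ultimately show ?thesis
    using sum_lessThan_telescope[of "\<lambda>m. F (X m)" "Suc M"] by (simp add: lessThan_Suc_atMost)
qed

lemma separately_holomorphic_lipschitz:
  assumes r: "0 < r"
    and hol: "\<And>w n. w \<in> polydisc N u (2 * r) \<Longrightarrow> n \<le> N - 2 \<Longrightarrow>
      (\<lambda>x. F (w(n := x))) holomorphic_on ball (u n) (2 * r)"
    and bd: "\<And>w. w \<in> polydisc N u (2 * r) \<Longrightarrow> cmod (F w) \<le> B"
    and dep: "\<And>w w'. (\<And>n. n \<le> N - 2 \<Longrightarrow> w n = w' n) \<Longrightarrow> F w = F w'"
    and w: "w \<in> polydisc N u r" and w': "w' \<in> polydisc N u r"
  shows "cmod (F w - F w') \<le> 2 * B / r * (\<Sum>n\<le>N - 2. cmod (w n - w' n))"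
proof -
  define X where "X m i = (if i < m then w i else w' i)" for m i
  have X: "X m \<in> polydisc N u (2 * r)" for m
    using w w' r by (force simp: X_def polydisc_def)
  have step: "cmod (F ((X m)(m := w m)) - F ((X m)(m := w' m))) \<le> 2 * B / r * cmod (w m - w' m)"
    if m: "m \<le> N - 2" for m
  proof -
    define f where "f x = F ((X m)(m := x))" for x
    have f: "f holomorphic_on ball (u m) (2 * r)"
      unfolding f_def by (rule hol[OF X m])
    have "cmod (f (w m) - f (w' m)) \<le> 2 * B / r * cmod (w m - w' m)"
    proof (rule field_differentiable_bound)
      fix x assume x: "x \<in> ball (u m) r"
      then show "(f has_field_derivative deriv f x) (at x within ball (u m) r)"
        using f r by (intro has_field_derivative_at_within[OF holomorphic_derivI[OF f]]) auto
      show "cmod (deriv f x) \<le> 2 * B / r"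
        by (rule Cauchy_Taylor_first_order(1)[OF f r _ x])
           (auto simp: f_def intro!: bd polydisc_upd X)
    qed (use w w' m in \<open>auto simp: polydisc_def\<close>)
    then show ?thesis by (simp add: f_def)
  qed
  have tel: "F w - F w' = (\<Sum>m\<le>N - 2. F ((X m)(m := w m)) - F ((X m)(m := w' m)))"
    unfolding X_def by (rule separately_holomorphic_telescope) (rule dep)
  have "cmod (F w - F w') \<le> (\<Sum>m\<le>N - 2. 2 * B / r * cmod (w m - w' m))"
    unfolding tel
    by (rule sum_norm_le) (use step in auto)
  then show ?thesis by (simp add: sum_distrib_left)
qed

lemma separately_holomorphic_differentiable:
  assumes r: "0 < r"
    and hol: "\<And>w n. w \<in> polydisc N u (2 * r) \<Longrightarrow> n \<le> N - 2 \<Longrightarrow>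
      (\<lambda>x. F (w(n := x))) holomorphic_on ball (u n) (2 * r)"
    and bd: "\<And>w. w \<in> polydisc N u (2 * r) \<Longrightarrow> cmod (F w) \<le> B"
    and dep: "\<And>w w'. (\<And>n. n \<le> N - 2 \<Longrightarrow> w n = w' n) \<Longrightarrow> F w = F w'"
  shows "\<exists>D. \<forall>e>0. \<exists>d>0. \<forall>w\<in>polydisc N u d.
    cmod (F w - F u - (\<Sum>n\<le>N - 2. D n * (w n - u n))) \<le> e * (\<Sum>n\<le>N - 2. cmod (w n - u n))"
proof -
  define D where "D n = deriv (\<lambda>x. F (u(n := x))) (u n)" for n
  define C where "C = 8 * B / r\<^sup>2"
  have upoly: "u \<in> polydisc N u s" if "s > 0" for s using that by (simp add: polydisc_def)
  have B0: "B \<ge> 0" by (rule order_trans[OF norm_ge_zero bd[OF upoly]]) (use r in simp)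
  then have C0: "C \<ge> 0" by (simp add: C_def)
  have main: "cmod (F w - F u - (\<Sum>n\<le>N - 2. D n * (w n - u n)))
      \<le> 2 * C * (\<Sum>n\<le>N - 2. cmod (w n - u n))\<^sup>2" if w: "w \<in> polydisc N u (r / 2)" for w
  proof -
    define S where "S = (\<Sum>n\<le>N - 2. cmod (w n - u n))"
    define X where "X m i = (if i < m then w i else u i)" for m i
    have S0: "S \<ge> 0" by (simp add: S_def sum_nonneg)
    have le_S: "cmod (w m - u m) \<le> S" if "m \<le> N - 2" for m
      unfolding S_def using that by (intro member_le_sum) auto
    have X1: "X m \<in> polydisc N u r" for m
      using w r by (force simp: X_def polydisc_def)
    then have X2: "X m \<in> polydisc N u (2 * r)" for m
      by (rule polydisc_mono) (use r in simp)
    have step: "cmod (F ((X m)(m := w m)) - F ((X m)(m := u m)) - D m * (w m - u m))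
        \<le> 2 * C * S * cmod (w m - u m)" if m: "m \<le> N - 2" for m
    proof -
      define f where "f x = F ((X m)(m := x))" for x
      define h where "h x = f x - F (u(m := x))" for x
      have f: "f holomorphic_on ball (u m) (2 * r)"
        unfolding f_def by (rule hol[OF X2 m])
      have u': "(\<lambda>x. F (u(m := x))) holomorphic_on ball (u m) (2 * r)"
        by (rule hol[OF upoly m]) (use r in simp)
      have hb: "cmod (h x) \<le> 2 * B / r * S" if x: "x \<in> ball (u m) r" for x
      proof -
        have "cmod (F ((X m)(m := x)) - F (u(m := x)))
            \<le> 2 * B / r * (\<Sum>n\<le>N - 2. cmod (((X m)(m := x)) n - (u(m := x)) n))"
          using polydisc_upd[OF X1 x] polydisc_upd[OF upoly[OF r] x]
          by (intro separately_holomorphic_lipschitz[OF r hol bd dep]) assumption+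
        also have "\<dots> \<le> 2 * B / r * S"
          unfolding S_def using B0 r
          by (intro mult_left_mono sum_mono) (auto simp: X_def)
        finally show ?thesis by (simp add: h_def f_def)
      qed
      have "h holomorphic_on ball (u m) r"
        unfolding h_def using f u' r
        by (intro holomorphic_intros) (auto intro: holomorphic_on_subset)
      then have hh: "h holomorphic_on ball (u m) (2 * (r / 2))" by simp
      have "cmod (deriv h (u m)) \<le> 2 * (2 * B / r * S) / (r / 2)"
        by (rule Cauchy_Taylor_first_order(1)[OF hh]) (use hb r in auto)
      also have "\<dots> = C * S" using r by (simp add: C_def power2_eq_square)
      also have "deriv h (u m) = deriv f (u m) - D m"
        unfolding h_def D_def using f u' r
        by (intro deriv_diff holomorphic_on_imp_differentiable_at[of _ "ball (u m) (2 * r)"]) auto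
      finally have d: "cmod (deriv f (u m) - D m) \<le> C * S" .
      have "cmod (f (w m) - f (u m) - deriv f (u m) * (w m - u m)) \<le> C * (cmod (w m - u m))\<^sup>2"
        unfolding C_def
        by (rule Cauchy_Taylor_first_order(2)[OF f r])
           (use w m r in \<open>auto simp: f_def polydisc_def intro!: bd polydisc_upd X2 less_le_trans[of _ "r / 2" r]\<close>)
      also have "\<dots> \<le> C * S * cmod (w m - u m)"
        using mult_left_mono[OF mult_right_mono[OF le_S[OF m] norm_ge_zero] C0]
        by (simp add: power2_eq_square mult.assoc)
      finally have t: "cmod (f (w m) - f (u m) - deriv f (u m) * (w m - u m)) \<le> C * S * cmod (w m - u m)" .
      have "f (w m) - f (u m) - D m * (w m - u m) =
          (f (w m) - f (u m) - deriv f (u m) * (w m - u m)) + (deriv f (u m) - D m) * (w m - u m)"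
        by (simp add: algebra_simps)
      then have "cmod (f (w m) - f (u m) - D m * (w m - u m))
          \<le> C * S * cmod (w m - u m) + C * S * cmod (w m - u m)"
        using t mult_right_mono[OF d, of "cmod (w m - u m)"]
        by (metis norm_triangle_le add_mono norm_mult norm_ge_zero)
      then show ?thesis by (simp add: f_def)
    qed
    have tel: "F w - F u = (\<Sum>m\<le>N - 2. F ((X m)(m := w m)) - F ((X m)(m := u m)))"
      unfolding X_def by (rule separately_holomorphic_telescope) (rule dep)
    have "F w - F u - (\<Sum>m\<le>N - 2. D m * (w m - u m)) =
        (\<Sum>m\<le>N - 2. F ((X m)(m := w m)) - F ((X m)(m := u m)) - D m * (w m - u m))"
      unfolding tel by (simp add: sum_subtractf)
    also have "cmod \<dots> \<le> (\<Sum>m\<le>N - 2. 2 * C * S * cmod (w m - u m))"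
      by (rule sum_norm_le) (use step in auto)
    also have "\<dots> = 2 * C * S\<^sup>2"
      by (simp add: sum_distrib_left[symmetric] S_def power2_eq_square)
    finally show ?thesis by (simp add: S_def)
  qed
  show ?thesis
  proof (intro exI[of _ D] allI impI)
    fix e :: real assume e: "e > 0"
    define K where "K = 2 * C * real (Suc (N - 2)) + 1"
    have K: "K > 0" using C0 by (simp add: K_def add_nonneg_pos)
    define d where "d = min (r / 2) (e / K)"
    have d: "d > 0" using r e K by (simp add: d_def)
    have "cmod (F w - F u - (\<Sum>n\<le>N - 2. D n * (w n - u n))) \<le> e * (\<Sum>n\<le>N - 2. cmod (w n - u n))"
      if w: "w \<in> polydisc N u d" for w
    proof -
      define S where "S = (\<Sum>n\<le>N - 2. cmod (w n - u n))"
      have S0: "S \<ge> 0" by (simp add: S_def sum_nonneg)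
      have "S \<le> (\<Sum>n\<le>N - 2. e / K)"
        unfolding S_def using w
        by (intro sum_mono) (auto simp: polydisc_def d_def dist_norm norm_minus_commute less_imp_le)
      then have "2 * C * S \<le> 2 * C * (real (Suc (N - 2)) * (e / K))"
        using C0 by (intro mult_left_mono) auto
      also have "\<dots> \<le> K * (e / K)"
        unfolding mult.assoc[symmetric] using e K by (intro mult_right_mono) (auto simp: K_def)
      also have "\<dots> = e" using K by simp
      finally have "2 * C * S * S \<le> e * S" using S0 by (rule mult_right_mono)
      moreover have "w \<in> polydisc N u (r / 2)" using w by (auto simp: polydisc_def d_def)
      ultimately show ?thesis using main[of w] by (simp add: S_def power2_eq_square mult.assoc)
    qed
    then show "\<exists>d>0. \<forall>w\<in>polydisc N u d.
        cmod (F w - F u - (\<Sum>n\<le>N - 2. D n * (w n - u n))) \<le> e * (\<Sum>n\<le>N - 2. cmod (w n - u n))"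
      using d by blast
  qed
qed

section \<open>The reduced curve\<close>

text \<open>The coefficients \<open>a\<^sub>n = v\<^sub>n b\<^sup>n\<close> come from the rescaling \<open>z = b s\<close> by the root \<open>b = z\<^sub>\<zeta>\<close>, which
  moves the branch point to \<open>s = 1\<close>: since \<open>P(b) = 0\<close> eliminates \<open>b\<^sup>N\<close>, one gets
  \<open>P(b s) = reduced N a s\<close>.\<close>

definition cofactor :: "nat \<Rightarrow> (nat \<Rightarrow> complex) \<Rightarrow> complex \<Rightarrow> complex" where
  "cofactor N a s = (\<Sum>j<N. s ^ j) - (\<Sum>n=1..N - 2. a n * (\<Sum>j=n..<N. s ^ j))"

definition cofactor_deriv :: "nat \<Rightarrow> (nat \<Rightarrow> complex) \<Rightarrow> complex \<Rightarrow> complex" where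
  "cofactor_deriv N a s =
     (\<Sum>j<N. of_nat j * s ^ (j - 1)) - (\<Sum>n=1..N - 2. a n * (\<Sum>j=n..<N. of_nat j * s ^ (j - 1)))"

definition reduced :: "nat \<Rightarrow> (nat \<Rightarrow> complex) \<Rightarrow> complex \<Rightarrow> complex" where
  "reduced N a s = (1 - s) * cofactor N a s"

definition reduced_deriv :: "nat \<Rightarrow> (nat \<Rightarrow> complex) \<Rightarrow> complex \<Rightarrow> complex" where
  "reduced_deriv N a s = (1 - s) * cofactor_deriv N a s - cofactor N a s"

definition tube_radius :: "nat \<Rightarrow> real" where
  "tube_radius N = 1 / (4 * real N ^ 2 * 2 ^ N)"

definition small_coeffs :: "nat \<Rightarrow> (nat \<Rightarrow> complex) \<Rightarrow> bool" where
  "small_coeffs N a \<longleftrightarrow> (\<Sum>n=1..N - 2. cmod (a n)) \<le> 1 / (16 * real N * 2 ^ N)"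

lemma tube_radius_pos: "N \<ge> 1 \<Longrightarrow> tube_radius N > 0"
  by (simp add: tube_radius_def)

lemma tube_radius_le: "N \<ge> 1 \<Longrightarrow> tube_radius N \<le> 1 / 8"
proof -
  assume N: "N \<ge> 1"
  have "1 * 2 ^ 1 \<le> real N ^ 2 * 2 ^ N"
    using N by (intro mult_mono power_increasing) (auto simp: one_le_power)
  then show ?thesis by (simp add: tube_radius_def field_simps)
qed

lemma tube_1E:
  assumes "s \<in> tube d 1"
  obtains \<sigma> where "\<sigma> \<in> {0..1}" "cmod (s - of_real \<sigma>) < d"
  using assms
  by (auto simp: tube_def closed_segment_def scaleR_conv_of_real dist_norm norm_minus_commute)

lemma of_real_in_tube_1: "\<sigma> \<in> {0..1} \<Longrightarrow> d > 0 \<Longrightarrow> of_real \<sigma> \<in> tube d 1"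
  unfolding tube_def
  by (rule UN_I[of "of_real \<sigma>"]) (auto simp: closed_segment_def scaleR_conv_of_real)

lemma ball_subset_tube: "ball \<zeta> \<rho> \<subseteq> tube \<rho> \<zeta>"
  by (auto simp: tube_def)

lemma open_tube: "open (tube d z)"
  by (auto simp: tube_def)

lemma tube_1_star:
  assumes s: "s \<in> tube d 1" and r: "r \<in> {0..1}"
  shows "1 - of_real r * (1 - s) \<in> tube d 1"
proof -
  obtain \<sigma> where \<sigma>: "\<sigma> \<in> {0..1}" "cmod (s - of_real \<sigma>) < d" using s by (rule tube_1E)
  define \<tau> where "\<tau> = 1 - r * (1 - \<sigma>)"
  have \<tau>: "\<tau> \<in> {0..1}" using r \<sigma>(1) by (auto simp: \<tau>_def mult_le_one)
  have "dist (of_real \<tau>) (1 - of_real r * (1 - s)) = r * cmod (s - of_real \<sigma>)"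
  proof -
    have "of_real \<tau> - (1 - of_real r * (1 - s)) = - (of_real r * (s - of_real \<sigma>))"
      by (simp add: \<tau>_def algebra_simps)
    then show ?thesis using r by (simp add: dist_norm norm_mult)
  qed
  also have "\<dots> \<le> cmod (s - of_real \<sigma>)" using r by (simp add: mult_left_le_one_le)
  finally have "dist (of_real \<tau>) (1 - of_real r * (1 - s)) < d" using \<sigma> by simp
  moreover have "of_real \<tau> \<in> closed_segment 0 (1::complex)"
    using \<tau> by (auto simp: closed_segment_def scaleR_conv_of_real)
  ultimately show ?thesis by (auto simp: tube_def)
qed

lemma cmod_tube_le_2:
  assumes "s \<in> tube (tube_radius N) 1" "N \<ge> 1"
  shows "cmod s \<le> 2"
proof -
  obtain \<sigma> where \<sigma>: "\<sigma> \<in> {0..1}" "cmod (s - of_real \<sigma>) < tube_radius N" using assms(1) by (rule tube_1E)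
  have "cmod s \<le> cmod (s - of_real \<sigma>) + cmod (of_real \<sigma>)"
    by (metis add.commute diff_add_cancel norm_triangle_ineq)
  then show ?thesis using \<sigma> tube_radius_le[OF assms(2)] by auto
qed

lemma norm_power_diff_2:
  fixes s t :: complex
  assumes "cmod s \<le> 2" "cmod t \<le> 2"
  shows "cmod (s ^ j - t ^ j) \<le> real j * 2 ^ j * cmod (s - t)"
proof -
  have "cmod ((s / 2) ^ j - (t / 2) ^ j) \<le> real j * cmod (s / 2 - t / 2)"
    by (rule norm_power_diff) (use assms in \<open>auto simp: norm_divide\<close>)
  also have "(s / 2) ^ j - (t / 2) ^ j = (s ^ j - t ^ j) / 2 ^ j"
    by (simp add: power_divide diff_divide_distrib)
  also have "s / 2 - t / 2 = (s - t) / 2" by (simp add: diff_divide_distrib)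
  finally have "cmod (s ^ j - t ^ j) \<le> real j * 2 ^ j * (cmod (s - t) / 2)"
    by (simp add: norm_divide norm_power field_simps)
  also have "\<dots> \<le> real j * 2 ^ j * cmod (s - t)" by (intro mult_left_mono) auto
  finally show ?thesis .
qed

lemma norm_power_le:
  assumes "cmod s \<le> 2" "j \<le> N"
  shows "cmod (s ^ j) \<le> 2 ^ N"
proof -
  have "cmod s ^ j \<le> 2 ^ j" using assms by (intro power_mono) auto
  also have "(2::real) ^ j \<le> 2 ^ N" using assms by (intro power_increasing) auto
  finally show ?thesis by (simp add: norm_power)
qed

lemma norm_sum_powers_le:
  assumes "cmod s \<le> 2" "finite A" "A \<subseteq> {..<N}"
  shows "cmod (\<Sum>j\<in>A. s ^ j) \<le> real N * 2 ^ N"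
    and "cmod (\<Sum>j\<in>A. of_nat j * s ^ (j - 1)) \<le> real N ^ 2 * 2 ^ N"
proof -
  have cA: "real (card A) \<le> real N"
    using card_mono[OF _ assms(3)] by simp
  have "cmod (\<Sum>j\<in>A. s ^ j) \<le> (\<Sum>j\<in>A. 2 ^ N)"
    using assms by (intro sum_norm_le norm_power_le) auto
  also have "\<dots> \<le> real N * 2 ^ N" using cA by simp
  finally show "cmod (\<Sum>j\<in>A. s ^ j) \<le> real N * 2 ^ N" .
  have "cmod (\<Sum>j\<in>A. of_nat j * s ^ (j - 1)) \<le> (\<Sum>j\<in>A. real N * 2 ^ N)"
  proof (rule sum_norm_le)
    fix j assume "j \<in> A"
    then have "j < N" using assms by auto
    then have "cmod (s ^ (j - 1)) \<le> 2 ^ N" by (intro norm_power_le assms) auto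
    then show "cmod (of_nat j * s ^ (j - 1)) \<le> real N * 2 ^ N"
      using \<open>j < N\<close> unfolding norm_mult norm_of_nat by (intro mult_mono) auto
  qed
  also have "\<dots> \<le> real N * (real N * 2 ^ N)"
    using cA mult_right_mono[of "real (card A)" "real N" "real N * 2 ^ N"] by simp
  finally show "cmod (\<Sum>j\<in>A. of_nat j * s ^ (j - 1)) \<le> real N ^ 2 * 2 ^ N"
    by (simp add: power2_eq_square mult.assoc)
qed

lemma norm_weighted_sum_le:
  assumes "\<And>n. n \<in> {1..N - 2} \<Longrightarrow> cmod (c n) \<le> C" "(\<Sum>n=1..N - 2. cmod (a n)) \<le> e" "0 \<le> C"
  shows "cmod (\<Sum>n=1..N - 2. a n * c n) \<le> e * C"
proof -
  have "cmod (\<Sum>n=1..N - 2. a n * c n) \<le> (\<Sum>n=1..N - 2. cmod (a n) * C)"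
    by (rule sum_norm_le) (use assms(1) in \<open>auto simp: norm_mult mult_left_mono\<close>)
  also have "\<dots> \<le> e * C"
    unfolding sum_distrib_right[symmetric] using assms by (intro mult_right_mono)
  finally show ?thesis .
qed

lemma small_coeffs_sum:
  assumes "small_coeffs N a" "cmod s \<le> 2" "N \<ge> 1"
  shows "cmod (\<Sum>n=1..N - 2. a n * (\<Sum>j=n..<N. s ^ j)) \<le> 1 / 16"
proof -
  have "cmod (\<Sum>n=1..N - 2. a n * (\<Sum>j=n..<N. s ^ j)) \<le> 1 / (16 * real N * 2 ^ N) * (real N * 2 ^ N)"
    using assms
    by (intro norm_weighted_sum_le norm_sum_powers_le) (auto simp: small_coeffs_def)
  then show ?thesis using assms by simp
qed

lemma Re_cofactor_ge:
  assumes s: "s \<in> tube (tube_radius N) 1" and a: "small_coeffs N a" and N: "N \<ge> 1"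
  shows "Re (cofactor N a s) \<ge> 1 / 2"
proof -
  obtain \<sigma> where \<sigma>: "\<sigma> \<in> {0..1}" "cmod (s - of_real \<sigma>) < tube_radius N" using s by (rule tube_1E)
  have s2: "cmod s \<le> 2" by (rule cmod_tube_le_2[OF s N])
  have "cmod (\<Sum>j<N. s ^ j - of_real \<sigma> ^ j) \<le> (\<Sum>j<N. real N * 2 ^ N * tube_radius N)"
  proof (rule sum_norm_le)
    fix j assume j: "j \<in> {..<N}"
    have "cmod (s ^ j - of_real \<sigma> ^ j) \<le> real j * 2 ^ j * cmod (s - of_real \<sigma>)"
      by (rule norm_power_diff_2) (use s2 \<sigma> in auto)
    also have "\<dots> \<le> real N * 2 ^ N * tube_radius N"
      using j \<sigma> by (intro mult_mono) auto
    finally show "cmod (s ^ j - of_real \<sigma> ^ j) \<le> real N * 2 ^ N * tube_radius N" .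
  qed
  also have "\<dots> = 1 / 4" using N by (simp add: tube_radius_def power2_eq_square)
  finally have 1: "cmod ((\<Sum>j<N. s ^ j) - (\<Sum>j<N. of_real \<sigma> ^ j)) \<le> 1 / 4"
    by (simp add: sum_subtractf)
  have "(1::real) = (\<Sum>j\<in>{0}. \<sigma> ^ j)" by simp
  also have "\<dots> \<le> (\<Sum>j<N. \<sigma> ^ j)" using N \<sigma> by (intro sum_mono2) auto
  also have "\<dots> = Re (\<Sum>j<N. of_real \<sigma> ^ j)" by (simp flip: of_real_power)
  finally have 2: "1 \<le> Re (\<Sum>j<N. of_real \<sigma> ^ j)" .
  show ?thesis
    using 1 2 small_coeffs_sum[OF a s2 N]
      abs_Re_le_cmod[of "(\<Sum>j<N. s ^ j) - (\<Sum>j<N. of_real \<sigma> ^ j)"]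
      abs_Re_le_cmod[of "\<Sum>n=1..N - 2. a n * (\<Sum>j=n..<N. s ^ j)"]
    unfolding cofactor_def minus_complex.sel by linarith
qed

lemma sum_powers_telescope:
  fixes s :: complex
  assumes "n \<le> N"
  shows "(1 - s) * (\<Sum>j=n..<N. s ^ j) = s ^ n - s ^ N"
  using assms
proof (induction N rule: dec_induct)
  case (step k)
  then have "(1 - s) * (\<Sum>j=n..<Suc k. s ^ j) = s ^ n - s ^ k + (1 - s) * s ^ k"
    by (simp add: distrib_left)
  then show ?case by (simp add: algebra_simps)
qed simp

lemma reduced_eq:
  "reduced N a s = 1 - s ^ N - (\<Sum>n=1..N - 2. a n * (s ^ n - s ^ N))"
proof -
  have "(1 - s) * (\<Sum>n=1..N - 2. a n * (\<Sum>j=n..<N. s ^ j)) =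
      (\<Sum>n=1..N - 2. a n * ((1 - s) * (\<Sum>j=n..<N. s ^ j)))"
    by (simp add: sum_distrib_left mult.left_commute)
  also have "\<dots> = (\<Sum>n=1..N - 2. a n * (s ^ n - s ^ N))"
    by (intro sum.cong refl) (subst sum_powers_telescope, auto)
  finally show ?thesis
    by (simp add: reduced_def cofactor_def right_diff_distrib flip: one_diff_power_eq)
qed

lemma cmod_reduced_le:
  assumes s: "s \<in> tube (tube_radius N) 1" and a: "small_coeffs N a" and N: "N \<ge> 1"
  shows "cmod (reduced N a s) \<le> 23 / 16"
proof -
  obtain \<sigma> where \<sigma>: "\<sigma> \<in> {0..1}" "cmod (s - of_real \<sigma>) < tube_radius N" using s by (rule tube_1E)
  have s2: "cmod s \<le> 2" by (rule cmod_tube_le_2[OF s N])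
  have "cmod (s ^ N - of_real \<sigma> ^ N) \<le> real N * 2 ^ N * cmod (s - of_real \<sigma>)"
    by (rule norm_power_diff_2) (use s2 \<sigma> in auto)
  also have "\<dots> \<le> real N * 2 ^ N * tube_radius N"
    using \<sigma> by (intro mult_left_mono) auto
  also have "\<dots> = 1 / (4 * real N)" using N by (simp add: tube_radius_def power2_eq_square)
  also have "\<dots> \<le> 1 / 4" using N by simp
  finally have 1: "cmod (s ^ N - of_real \<sigma> ^ N) \<le> 1 / 4" .
  have 2: "cmod (1 - of_real \<sigma> ^ N) \<le> 1"
  proof -
    have "1 - of_real \<sigma> ^ N = complex_of_real (1 - \<sigma> ^ N)" by simp
    then show ?thesis
      using \<sigma> power_le_one[of \<sigma> N] by (simp only: norm_of_real) auto
  qed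
  define E where "E = (\<Sum>n=1..N - 2. a n * (\<Sum>j=n..<N. s ^ j))"
  have "cmod (1 - s) \<le> 3" using norm_triangle_ineq4[of 1 s] s2 by simp
  then have 3: "cmod ((1 - s) * E) \<le> 3 * (1 / 16)"
    unfolding norm_mult E_def by (intro mult_mono small_coeffs_sum[OF a s2 N]) auto
  have "reduced N a s = (1 - of_real \<sigma> ^ N) - (s ^ N - of_real \<sigma> ^ N) - (1 - s) * E"
    by (simp add: reduced_def cofactor_def E_def right_diff_distrib flip: one_diff_power_eq)
  also have "cmod \<dots> \<le> 1 + 1 / 4 + 3 * (1 / 16)"
    using 1 2 3 norm_triangle_ineq4[of "1 - of_real \<sigma> ^ N" "s ^ N - of_real \<sigma> ^ N"]
    by (intro norm_triangle_le_diff) linarith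
  finally show ?thesis by simp
qed

lemma Re_two_minus_ge:
  assumes "s \<in> tube (tube_radius N) 1" "small_coeffs N a" "N \<ge> 1" "cmod v < 4 / 3"
  shows "Re (2 - v * reduced N a s) \<ge> 1 / 12"
proof -
  have "cmod (v * reduced N a s) \<le> 4 / 3 * (23 / 16)"
    unfolding norm_mult using assms by (intro mult_mono cmod_reduced_le) auto
  then show ?thesis using abs_Re_le_cmod[of "v * reduced N a s"] by simp
qed

lemma reduced_has_derivative:
  "(reduced N a has_field_derivative reduced_deriv N a s) (at s)"
proof -
  have "(cofactor N a has_field_derivative cofactor_deriv N a s) (at s)"
    unfolding cofactor_def cofactor_deriv_def
    by (auto intro!: derivative_eq_intros sum.cong)
  then show ?thesis
    unfolding reduced_def reduced_deriv_def by (auto intro!: derivative_eq_intros)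
qed

lemma cmod_reduced_deriv_le:
  assumes s2: "cmod s \<le> 2" and a: "small_coeffs N a" and N: "N \<ge> 1"
  shows "cmod (reduced_deriv N a s) \<le> 8 * (real N ^ 2 * 2 ^ N)"
proof -
  define C where "C = real N ^ 2 * 2 ^ N"
  have "1 * 1 \<le> real N * 2 ^ N" by (rule mult_mono) (use N in auto)
  then have NN: "1 \<le> real N * 2 ^ N" by simp
  then have "1 / (16 * real N * 2 ^ N) \<le> 1" by (simp add: mult.assoc)
  then have a1: "(\<Sum>n=1..N - 2. cmod (a n)) \<le> 1" using a by (simp add: small_coeffs_def)
  have NC: "real N * 2 ^ N \<le> C"
    using N by (simp add: C_def power2_eq_square)
  have C0: "C \<ge> 0" by (simp add: C_def)
  have "cmod (\<Sum>n=1..N - 2. a n * (\<Sum>j=n..<N. of_nat j * s ^ (j - 1))) \<le> 1 * C"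
    unfolding C_def
    by (rule norm_weighted_sum_le[OF _ a1], rule norm_sum_powers_le(2)[OF s2]) auto
  moreover have "cmod (\<Sum>j<N. of_nat j * s ^ (j - 1)) \<le> C"
    unfolding C_def by (intro norm_sum_powers_le s2) auto
  ultimately have 1: "cmod (cofactor_deriv N a s) \<le> 2 * C"
    unfolding cofactor_deriv_def by (intro norm_triangle_le_diff) linarith
  have "cmod (\<Sum>j<N. s ^ j) \<le> real N * 2 ^ N" by (intro norm_sum_powers_le s2) auto
  moreover have "1 \<le> C" using NN NC by linarith
  ultimately have 2: "cmod (cofactor N a s) \<le> 2 * C"
    unfolding cofactor_def using small_coeffs_sum[OF a s2 N] NC
    by (intro norm_triangle_le_diff) linarith
  have "cmod (1 - s) \<le> 3" using norm_triangle_ineq4[of 1 s] s2 by simp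
  then have "cmod ((1 - s) * cofactor_deriv N a s) \<le> 3 * (2 * C)"
    unfolding norm_mult using 1 by (intro mult_mono) auto
  then show ?thesis
    unfolding reduced_deriv_def C_def[symmetric] using 2
    by (intro norm_triangle_le_diff) linarith
qed

text \<open>With \<open>p\<close>, \<open>k\<close> the reduced polynomial and its cofactor, \<open>y\<^sup>2 = - v (1 - s) k (2 - v p)\<close>.
  The factor \<open>\<surd>(1 - s)\<close> missing from the integrand below is removed by \<open>s = 1 - \<sigma>\<^sup>2\<close>.\<close>

definition integrand :: "nat \<Rightarrow> complex \<Rightarrow> (nat \<Rightarrow> complex) \<Rightarrow> complex \<Rightarrow> complex" where
  "integrand N v a s =
     s * reduced_deriv N a s / (csqrt (cofactor N a s) * csqrt (2 - v * reduced N a s))"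

definition period :: "nat \<Rightarrow> complex \<Rightarrow> (nat \<Rightarrow> complex) \<Rightarrow> complex" where
  "period N v a = integral {0..1} (\<lambda>\<sigma>. integrand N v a (1 - of_real (\<sigma>\<^sup>2)))"

lemma not_nonpos_Reals_if_Re_pos: "0 < Re z \<Longrightarrow> z \<notin> \<real>\<^sub>\<le>\<^sub>0"
  by (auto simp: complex_nonpos_Reals_iff)

lemma integrand_holomorphic:
  assumes a: "small_coeffs N a" and N: "N \<ge> 1" and v: "cmod v < 4 / 3"
  shows "integrand N v a holomorphic_on tube (tube_radius N) 1"
proof -
  have k: "cofactor N a s \<notin> \<real>\<^sub>\<le>\<^sub>0" "2 - v * reduced N a s \<notin> \<real>\<^sub>\<le>\<^sub>0"
    if "s \<in> tube (tube_radius N) 1" for s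
    using Re_cofactor_ge[OF that a N] Re_two_minus_ge[OF that a N v]
    by (auto intro!: not_nonpos_Reals_if_Re_pos simp del: minus_complex.sel)
  then have "cofactor N a s \<noteq> 0" "2 - v * reduced N a s \<noteq> 0" if "s \<in> tube (tube_radius N) 1" for s
    using that by force+
  with k show ?thesis
    unfolding integrand_def reduced_deriv_def reduced_def cofactor_deriv_def cofactor_def
    by (intro holomorphic_intros) (auto simp: algebra_simps)
qed

lemma cmod_csqrt_ge:
  assumes "Re z \<ge> c" "c > 0" 
  shows "cmod (csqrt z) \<ge> sqrt c"
proof -
  have "c \<le> cmod z" using assms complex_Re_le_cmod[of z] by linarith
  then show ?thesis by (simp add: norm_csqrt)
qed

lemma cmod_integrand_le:
  assumes s: "s \<in> tube (tube_radius N) 1" and a: "small_coeffs N a" and N: "N \<ge> 1" and v: "cmod v < 4 / 3"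
  shows "cmod (integrand N v a s) \<le> 2 * (8 * (real N ^ 2 * 2 ^ N)) / (sqrt (1 / 2) * sqrt (1 / 12))"
  unfolding integrand_def norm_divide norm_mult
proof (rule frac_le)
  show "sqrt (1 / 2) * sqrt (1 / 12)
      \<le> cmod (csqrt (cofactor N a s)) * cmod (csqrt (2 - v * reduced N a s))"
    by (rule mult_mono[OF cmod_csqrt_ge[OF Re_cofactor_ge[OF s a N]]
          cmod_csqrt_ge[OF Re_two_minus_ge[OF s a N v]]]) simp_all
  show "cmod s * cmod (reduced_deriv N a s) \<le> 2 * (8 * (real N ^ 2 * 2 ^ N))"
    by (rule mult_mono[OF cmod_tube_le_2[OF s N] cmod_reduced_deriv_le[OF cmod_tube_le_2[OF s N] a N]])
       simp_all
qed simp_all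

lemma one_minus_square_in_tube:
  assumes "N \<ge> 1" "\<sigma> \<in> {0..1}"
  shows "1 - of_real (\<sigma>\<^sup>2) \<in> tube (tube_radius N) 1"
  using of_real_in_tube_1[of "1 - \<sigma>\<^sup>2" "tube_radius N"] assms tube_radius_pos[of N]
  by (auto simp: power_le_one)

lemma period_holomorphic:
  fixes v :: "complex \<Rightarrow> complex" and a :: "complex \<Rightarrow> nat \<Rightarrow> complex"
  assumes U: "open U" and N: "N \<ge> 1"
    and v: "v holomorphic_on U" "\<And>x. x \<in> U \<Longrightarrow> cmod (v x) < 4 / 3"
    and a: "\<And>n. n \<in> {1..N - 2} \<Longrightarrow> (\<lambda>x. a x n) holomorphic_on U" "\<And>x. x \<in> U \<Longrightarrow> small_coeffs N (a x)"
  shows "(\<lambda>x. period N (v x) (a x)) holomorphic_on U"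
  unfolding period_def
proof (rule holomorphic_on_integral[OF U])
  fix t :: real assume "t \<in> {0..1}"
  then have s: "1 - of_real (t\<^sup>2) \<in> tube (tube_radius N) 1" using one_minus_square_in_tube N by blast
  define s :: complex where "s = 1 - of_real (t\<^sup>2)"
  note s = s[folded s_def]
  have k: "cofactor N (a x) s \<notin> \<real>\<^sub>\<le>\<^sub>0" "2 - v x * reduced N (a x) s \<notin> \<real>\<^sub>\<le>\<^sub>0"
    if "x \<in> U" for x
    using Re_cofactor_ge[OF s a(2)[OF that] N] Re_two_minus_ge[OF s a(2)[OF that] N v(2)[OF that]]
    by (auto intro!: not_nonpos_Reals_if_Re_pos simp del: minus_complex.sel)
  then have k0: "cofactor N (a x) s \<noteq> 0" "2 - v x * reduced N (a x) s \<noteq> 0" if "x \<in> U" for x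
    using that by force+
  have "(\<lambda>x. cofactor N (a x) s) holomorphic_on U" "(\<lambda>x. cofactor_deriv N (a x) s) holomorphic_on U"
    unfolding cofactor_def cofactor_deriv_def by (intro holomorphic_intros a; simp)+
  then show "(\<lambda>x. integrand N (v x) (a x) (1 - of_real (t\<^sup>2))) holomorphic_on U"
    using k k0 v(1)
    unfolding s_def[symmetric] integrand_def reduced_deriv_def reduced_def
    by (intro holomorphic_intros) auto
next
  fix x assume x: "x \<in> U"
  have "continuous_on {0..1} (\<lambda>\<sigma>. integrand N (v x) (a x) (1 - of_real (\<sigma>\<^sup>2)))"
    by (rule continuous_on_compose2[OF holomorphic_on_imp_continuous_on[OF integrand_holomorphic[OF a(2)[OF x] N v(2)[OF x]]]])
       (use one_minus_square_in_tube[OF N] in \<open>auto intro!: continuous_intros simp del: of_real_power\<close>)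
  then show "(\<lambda>\<sigma>. integrand N (v x) (a x) (1 - of_real (\<sigma>\<^sup>2))) integrable_on {0..1}"
    by (rule integrable_continuous_real)
  fix t :: real assume "t \<in> {0..1}"
  then show "cmod (integrand N (v x) (a x) (1 - of_real (t\<^sup>2))) \<le>
      2 * (8 * (real N ^ 2 * 2 ^ N)) / (sqrt (1 / 2) * sqrt (1 / 12))"
    by (intro cmod_integrand_le one_minus_square_in_tube a(2) v(2) x N)
qed

lemma cmod_period_le:
  assumes a: "small_coeffs N a" and N: "N \<ge> 1" and v: "cmod v < 4 / 3"
  shows "cmod (period N v a) \<le> 2 * (8 * (real N ^ 2 * 2 ^ N)) / (sqrt (1 / 2) * sqrt (1 / 12))"
proof -
  have "continuous_on {0..1} (\<lambda>\<sigma>. integrand N v a (1 - of_real (\<sigma>\<^sup>2)))"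
    by (rule continuous_on_compose2[OF holomorphic_on_imp_continuous_on[OF integrand_holomorphic[OF a N v]]])
       (use one_minus_square_in_tube[OF N] in \<open>auto intro!: continuous_intros simp del: of_real_power\<close>)
  then have "norm (integral {0..1} (\<lambda>\<sigma>. integrand N v a (1 - of_real (\<sigma>\<^sup>2))))
      \<le> 2 * (8 * (real N ^ 2 * 2 ^ N)) / (sqrt (1 / 2) * sqrt (1 / 12)) * (1 - 0)"
  proof (rule integral_bound[rotated])
    fix t :: real assume "t \<in> {0..1}"
    then show "cmod (integrand N v a (1 - of_real (t\<^sup>2))) \<le>
        2 * (8 * (real N ^ 2 * 2 ^ N)) / (sqrt (1 / 2) * sqrt (1 / 12))"
      by (intro cmod_integrand_le one_minus_square_in_tube a v N)
  qed simp
  then show ?thesis by (simp add: period_def)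
qed

section \<open>Integration along lifted paths\<close>

lemma cofactor_0: "N \<ge> 1 \<Longrightarrow> cofactor N a 0 = 1"
proof -
  assume N: "N \<ge> 1"
  have "(\<Sum>j<N. (0::complex) ^ j) = (\<Sum>j\<in>{0}. 0 ^ j)"
    using N by (intro sum.mono_neutral_right) auto
  moreover have "(\<Sum>j=n..<N. (0::complex) ^ j) = 0" if "n \<in> {1..N - 2}" for n
    using that by (intro sum.neutral) (auto simp: power_0_left)
  ultimately show ?thesis by (simp add: cofactor_def)
qed

lemma valid_path_cmult:
  fixes \<gamma> :: "real \<Rightarrow> complex"
  shows "valid_path \<gamma> \<Longrightarrow> valid_path (\<lambda>t. c * \<gamma> t)"
  using valid_path_compose_holomorphic[of \<gamma> "\<lambda>z. c * z" UNIV]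
  by (auto simp: o_def intro!: holomorphic_intros)

context
  fixes N :: nat and a :: "nat \<Rightarrow> complex" and v \<beta> :: complex and A :: "complex poly"
  assumes N: "N \<ge> 1" and a: "small_coeffs N a" and v: "cmod v < 4 / 3" and \<beta>: "\<beta> \<noteq> 0"
    and A: "\<And>s. poly A (\<beta> * s) = v * reduced N a s - 1"
begin

lemma sqrt_factor_nz:
  assumes "s \<in> tube (tube_radius N) 1"
  shows "cofactor N a s \<notin> \<real>\<^sub>\<le>\<^sub>0" "2 - v * reduced N a s \<notin> \<real>\<^sub>\<le>\<^sub>0"
    "cofactor N a s \<noteq> 0" "2 - v * reduced N a s \<noteq> 0"
proof -
  show *: "cofactor N a s \<notin> \<real>\<^sub>\<le>\<^sub>0" "2 - v * reduced N a s \<notin> \<real>\<^sub>\<le>\<^sub>0"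
    using Re_cofactor_ge[OF assms a N] Re_two_minus_ge[OF assms a N v]
    by (auto intro!: not_nonpos_Reals_if_Re_pos simp del: minus_complex.sel)
  show "cofactor N a s \<noteq> 0" "2 - v * reduced N a s \<noteq> 0" using * by force+
qed

lemma sqrt_factor_continuous:
  "continuous_on (tube (tube_radius N) 1) (\<lambda>s. csqrt (cofactor N a s) * csqrt (2 - v * reduced N a s))"
proof (intro holomorphic_on_imp_continuous_on holomorphic_intros)
  show "cofactor N a holomorphic_on tube (tube_radius N) 1"
    unfolding cofactor_def by (intro holomorphic_intros)
  show "reduced N a holomorphic_on tube (tube_radius N) 1"
    unfolding reduced_def cofactor_def by (intro holomorphic_intros)
qed (use sqrt_factor_nz in auto)

lemma curve_scaled: "(poly A (\<beta> * s))\<^sup>2 - 1 = - v * (1 - s) * (cofactor N a s * (2 - v * reduced N a s))"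
  unfolding A by (simp add: reduced_def algebra_simps power2_eq_square)

lemma pderiv_scaled: "\<beta> * poly (pderiv A) (\<beta> * s) = v * reduced_deriv N a s"
proof -
  have "((\<lambda>s. poly A (\<beta> * s)) has_field_derivative \<beta> * poly (pderiv A) (\<beta> * s)) (at s)"
    by (auto intro!: derivative_eq_intros DERIV_chain2[OF poly_DERIV])
  moreover have "((\<lambda>s. poly A (\<beta> * s)) has_field_derivative v * reduced_deriv N a s) (at s)"
    unfolding A by (auto intro!: derivative_eq_intros reduced_has_derivative)
  ultimately show ?thesis by (rule DERIV_unique)
qed

lemma lifted_integral:
  assumes \<gamma>: "valid_path \<gamma>" "pathstart \<gamma> = 0" "pathfinish \<gamma> = \<beta>"
      "\<And>t. t \<in> {0..1} \<Longrightarrow> \<gamma> t / \<beta> \<in> tube (tube_radius N) 1"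
    and Y: "continuous_on {0..1} Y" "\<And>t. t \<in> {0..1} \<Longrightarrow> (Y t)\<^sup>2 = (poly A (\<gamma> t))\<^sup>2 - 1"
      "\<And>t. t \<in> {0..<1} \<Longrightarrow> Y t \<noteq> 0"
  shows "((\<lambda>t. \<gamma> t * poly (pderiv A) (\<gamma> t) / Y t * vector_derivative \<gamma> (at t within {0..1}))
          has_integral 2 * \<beta> * v * csqrt (2 - v) / Y 0 * period N v a) {0..1}"
proof -
  define g where "g t = inverse \<beta> * \<gamma> t" for t
  have \<gamma>g: "\<gamma> t = \<beta> * g t" for t using \<beta> by (simp add: g_def)
  have g_tube: "g t \<in> tube (tube_radius N) 1" if "t \<in> {0..1}" for t
    using \<gamma>(4)[OF that] by (simp add: g_def field_simps)
  have g0: "g 0 = 0" and g1: "g 1 = 1"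
    using \<gamma> \<beta> by (auto simp: g_def pathstart_def pathfinish_def)
  define S where "S s = csqrt (cofactor N a s) * csqrt (2 - v * reduced N a s)" for s
  have S_nz: "S s \<noteq> 0" if "s \<in> tube (tube_radius N) 1" for s
    using sqrt_factor_nz[OF that] by (simp add: S_def)
  have S_sq: "(S s)\<^sup>2 = cofactor N a s * (2 - v * reduced N a s)" for s
    by (simp add: S_def power_mult_distrib)
  define T where "T t = Y t / S (g t)" for t
  have gv: "valid_path g" unfolding g_def by (rule valid_path_cmult[OF \<gamma>(1)])
  have gc: "continuous_on {0..1} g"
    using valid_path_imp_path[OF gv] by (simp add: path_def)
  have L: "((\<lambda>t. integrand N v a (g t) / T t * vector_derivative g (at t within {0..1})) has_integral
      2 / T 0 * integral {0..1} (\<lambda>\<sigma>. integrand N v a (1 - of_real (\<sigma>\<^sup>2)))) {0..1}"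
  proof (rule sqrt_path_integral[where c = "- v"])
    show "integrand N v a holomorphic_on tube (tube_radius N) 1"
      by (rule integrand_holomorphic[OF a N v])
    show "path_image g \<subseteq> tube (tube_radius N) 1" using g_tube by (auto simp: path_image_def)
    show "continuous_on {0..1} T"
      unfolding T_def
    proof (intro continuous_intros Y)
      show "continuous_on {0..1} (\<lambda>t. S (g t))"
        unfolding S_def by (rule continuous_on_compose2[OF sqrt_factor_continuous gc]) (use g_tube in auto)
    qed (use S_nz g_tube in auto)
    fix t :: real
    show "(T t)\<^sup>2 = - v * (1 - g t)" if t: "t \<in> {0..1}"
    proof -
      have "(T t)\<^sup>2 * (S (g t))\<^sup>2 = - v * (1 - g t) * (S (g t))\<^sup>2"
        using S_nz[OF g_tube[OF t]] Y(2)[OF t] unfolding \<gamma>g curve_scaled S_sq[symmetric]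
        by (simp add: T_def power_divide)
      then show ?thesis using S_nz[OF g_tube[OF t]] by (subst (asm) mult_right_cancel) auto
    qed
    show "T t \<noteq> 0" if "t \<in> {0..<1}"
      using Y(3)[OF that] S_nz[OF g_tube[of t]] that by (simp add: T_def)
  qed (use gv g0 g1 open_tube tube_1_star in \<open>auto simp: pathstart_def pathfinish_def\<close>)
  have T0: "T 0 = Y 0 / csqrt (2 - v)"
    using cofactor_0[OF N] by (simp add: T_def S_def g0 reduced_def)
  obtain E where E: "finite E" "\<And>t. t \<in> {0..1} - E \<Longrightarrow> \<gamma> differentiable at t"
    using \<gamma>(1) by (auto simp: valid_path_def piecewise_C1_differentiable_on_def C1_differentiable_on_eq)
  have "((\<lambda>t. (\<beta> * v) * (integrand N v a (g t) / T t * vector_derivative g (at t within {0..1}))) has_integral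
      (\<beta> * v) * (2 / T 0 * period N v a)) {0..1}"
    unfolding period_def by (rule has_integral_mult_right[OF L])
  then have "((\<lambda>t. \<gamma> t * poly (pderiv A) (\<gamma> t) / Y t * vector_derivative \<gamma> (at t within {0..1})) has_integral
      (\<beta> * v) * (2 / T 0 * period N v a)) {0..1}"
  proof (rule has_integral_spike_finite[rotated 2])
    show "finite (E \<union> {0, 1})" using E by simp
    fix t assume t: "t \<in> {0..1} - (E \<union> {0, 1})"
    then have "(\<gamma> has_vector_derivative vector_derivative \<gamma> (at t)) (at t)"
      using E(2)[of t] by (simp add: vector_derivative_works)
    then have d: "(\<gamma> has_vector_derivative vector_derivative \<gamma> (at t within {0..1})) (at t within {0..1})"
      using t by (auto simp: vector_derivative_at_within_ivl intro: has_vector_derivative_at_within)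
    have "(g has_vector_derivative inverse \<beta> * vector_derivative \<gamma> (at t within {0..1})) (at t within {0..1})"
      unfolding g_def by (rule has_vector_derivative_mult_right[OF d])
    then have g': "vector_derivative g (at t within {0..1}) = inverse \<beta> * vector_derivative \<gamma> (at t within {0..1})"
      using t by (intro vector_derivative_within_closed_interval) auto
    have "integrand N v a (g t) / T t = g t * reduced_deriv N a (g t) / Y t"
      using S_nz[OF g_tube[of t]] t unfolding integrand_def T_def S_def[symmetric] by simp
    moreover have "\<gamma> t * poly (pderiv A) (\<gamma> t) = g t * (v * reduced_deriv N a (g t))"
      using pderiv_scaled[of "g t"] by (simp add: \<gamma>g mult_ac)
    ultimately show "\<gamma> t * poly (pderiv A) (\<gamma> t) / Y t * vector_derivative \<gamma> (at t within {0..1}) =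
        (\<beta> * v) * (integrand N v a (g t) / T t * vector_derivative g (at t within {0..1}))"
      using \<beta> by (simp add: g')
  qed
  moreover have "(\<beta> * v) * (2 / T 0 * period N v a) = 2 * \<beta> * v * csqrt (2 - v) / Y 0 * period N v a"
    by (simp add: T0)
  ultimately show ?thesis by metis
qed

lemma segment_lift:
  assumes v0: "v \<noteq> 0"
  obtains Y where "continuous_on {0..1} Y"
    "\<And>t. t \<in> {0..1} \<Longrightarrow> (Y t)\<^sup>2 = (poly A (\<beta> * of_real t))\<^sup>2 - 1"
    "\<And>t. t \<in> {0..<1} \<Longrightarrow> Y t \<noteq> 0" "Y 0 = - \<i> * csqrt (v * (2 - v))"
proof
  define c where "c = - \<i> * csqrt (v * (2 - v)) / csqrt (2 - v)"
  define S where "S s = csqrt (cofactor N a s) * csqrt (2 - v * reduced N a s)" for s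
  define Y where "Y t = c * of_real (sqrt (1 - t)) * S (of_real t)" for t :: real
  have tube: "of_real t \<in> tube (tube_radius N) 1" if "t \<in> {0..1}" for t
    using of_real_in_tube_1[OF that tube_radius_pos[OF N]] .
  have v2: "2 - v \<noteq> 0" using v by auto
  have c: "c\<^sup>2 = - v" using v2 by (simp add: c_def power_divide power_mult_distrib)
  show "continuous_on {0..1} Y"
    unfolding Y_def S_def
    by (intro continuous_intros continuous_on_compose2[OF sqrt_factor_continuous]) (use tube in auto)
  fix t :: real
  show "(Y t)\<^sup>2 = (poly A (\<beta> * of_real t))\<^sup>2 - 1" if "t \<in> {0..1}"
  proof -
    have "(complex_of_real (sqrt (1 - t)))\<^sup>2 = 1 - of_real t"
      using that by (simp flip: of_real_power)
    then show ?thesis unfolding curve_scaled by (simp add: Y_def S_def power_mult_distrib c)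
  qed
  show "Y t \<noteq> 0" if "t \<in> {0..<1}"
    using c v0 that sqrt_factor_nz[OF tube[of t]] by (auto simp: Y_def S_def)
  show "Y 0 = - \<i> * csqrt (v * (2 - v))"
    using v2 cofactor_0[OF N] by (simp add: Y_def S_def c_def reduced_def)
qed

end

section \<open>The root of the rescaled polynomial\<close>

lemma poly_AD_poly:
  "poly (AD_poly N w) z = z ^ N - (\<Sum>n=1..N - 2. w n * z ^ n) + 1"
  by (simp add: AD_poly_def poly_sum poly_monom)

lemma cmod_poly_roots_ge:
  assumes "\<And>x. x \<in># A \<Longrightarrow> \<rho> \<le> cmod (z - x)" "0 \<le> \<rho>"
  shows "\<rho> ^ size A \<le> cmod (poly (\<Prod>x\<in>#A. [:- x, 1:]) z)"
  using assms(1)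
proof (induction A)
  case (add x A)
  have "\<rho> * \<rho> ^ size A \<le> cmod (z - x) * cmod (poly (\<Prod>x\<in>#A. [:- x, 1:]) z)"
    using assms(2) add by (intro mult_mono) auto
  then show ?case by (simp add: norm_mult[symmetric] left_diff_distrib)
qed simp

definition moduli_radius :: "nat \<Rightarrow> real" where
  "moduli_radius N = min (1 / (16 * real N ^ 2 * 4 ^ N)) ((tube_radius N / 8) ^ N / real N)"

definition small_moduli :: "nat \<Rightarrow> (nat \<Rightarrow> complex) \<Rightarrow> bool" where
  "small_moduli N w \<longleftrightarrow> (\<forall>n\<in>{1..N - 2}. cmod (w n) < moduli_radius N)"

definition AD_root :: "nat \<Rightarrow> complex \<Rightarrow> (nat \<Rightarrow> complex) \<Rightarrow> complex" where
  "AD_root N \<zeta> w = (SOME z. cmod (z - \<zeta>) < tube_radius N / 8 \<and> poly (AD_poly N w) z = 0)"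

definition root_coeffs :: "nat \<Rightarrow> complex \<Rightarrow> (nat \<Rightarrow> complex) \<Rightarrow> nat \<Rightarrow> complex" where
  "root_coeffs N \<zeta> w n = w n * AD_root N \<zeta> w ^ n"

context
  fixes N :: nat and \<zeta> :: complex
  assumes N: "3 \<le> N" and \<zeta>: "\<zeta> ^ N = -1"
begin

lemma one_le_N: "N \<ge> 1" using N by simp

lemma cmod_zeta: "cmod \<zeta> = 1"
proof -
  have "cmod (\<zeta> ^ N) = 1" by (simp add: \<zeta>)
  then have "cmod \<zeta> ^ N = 1 ^ N" by (simp add: norm_power)
  then show ?thesis by (rule power_eq_imp_eq_base) (use N in auto)
qed

lemma moduli_radius_pos: "moduli_radius N > 0"
  using N tube_radius_pos[OF one_le_N] by (simp add: moduli_radius_def)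

lemma AD_poly_root_near:
  assumes "0 < \<rho>" and w: "(\<Sum>n=1..N - 2. cmod (w n)) < \<rho> ^ N"
  shows "\<exists>z. cmod (z - \<zeta>) < \<rho> \<and> poly (AD_poly N w) z = 0"
proof (rule ccontr)
  assume no: "\<not> ?thesis"
  define P where "P = AD_poly N w"
  have "degree (1 - (\<Sum>n=1..N - 2. monom (w n) n)) \<le> N - 2"
    by (intro degree_diff_le degree_sum_le) (auto intro: order_trans[OF degree_monom_le])
  then have "degree (1 - (\<Sum>n=1..N - 2. monom (w n) n)) < degree (monom (1::complex) N)"
    using N by (simp add: degree_monom_eq)
  moreover have P_eq: "P = monom 1 N + (1 - (\<Sum>n=1..N - 2. monom (w n) n))"
    by (simp add: P_def AD_poly_def)
  ultimately have deg: "degree P = N" "lead_coeff P = 1"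
    by (simp_all add: degree_add_eq_left degree_monom_eq coeff_eq_0 del: coeff_diff)
  then have "P \<noteq> 0" by auto
  then obtain R where R: "size R = N" "P = (\<Prod>x\<in>#R. [:- x, 1:])"
    using alg_closed_imp_factorization[of P] deg by auto
  have "\<rho> \<le> cmod (\<zeta> - x)" if "x \<in># R" for x
  proof -
    have "poly P x = 0"
      unfolding R(2) using that by (auto simp: poly_prod_mset prod_mset_zero_iff)
    then show ?thesis using no by (force simp: P_def norm_minus_commute)
  qed
  then have "\<rho> ^ N \<le> cmod (poly P \<zeta>)"
    using cmod_poly_roots_ge[of R \<rho> \<zeta>] R assms by simp
  also have "poly P \<zeta> = - (\<Sum>n=1..N - 2. w n * \<zeta> ^ n)"
    by (simp add: P_def poly_AD_poly \<zeta>)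
  also have "cmod \<dots> \<le> (\<Sum>n=1..N - 2. cmod (w n))"
    unfolding norm_minus_cancel
    by (rule sum_norm_le) (simp add: norm_mult norm_power cmod_zeta)
  finally show False using w by simp
qed

lemma sum_lt_if_bounded:
  assumes "\<And>n. n \<in> {1..N - 2} \<Longrightarrow> cmod (w n) < e" "e > 0" "e \<le> c / real N"
  shows "(\<Sum>n=1..N - 2. cmod (w n)) < c"
proof -
  have "(\<Sum>n=1..N - 2. cmod (w n)) \<le> (\<Sum>n=1..N - 2. e)"
    by (rule sum_mono) (use assms(1) in \<open>auto intro: less_imp_le\<close>)
  also have "\<dots> = real (N - 2) * e" by simp
  also have "\<dots> < real N * e" using N assms(2) by simp
  also have "\<dots> \<le> c" using assms(3) N by (simp add: field_simps)
  finally show ?thesis .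
qed

lemma AD_root_props:
  assumes "small_moduli N w"
  shows "cmod (AD_root N \<zeta> w - \<zeta>) < tube_radius N / 8" "poly (AD_poly N w) (AD_root N \<zeta> w) = 0"
proof -
  have "(\<Sum>n=1..N - 2. cmod (w n)) < (tube_radius N / 8) ^ N"
    by (rule sum_lt_if_bounded[OF _ moduli_radius_pos])
       (use assms in \<open>auto simp: small_moduli_def moduli_radius_def\<close>)
  then have "\<exists>z. cmod (z - \<zeta>) < tube_radius N / 8 \<and> poly (AD_poly N w) z = 0"
    using tube_radius_pos[OF one_le_N] by (intro AD_poly_root_near) auto
  from someI_ex[OF this]
  show "cmod (AD_root N \<zeta> w - \<zeta>) < tube_radius N / 8" "poly (AD_poly N w) (AD_root N \<zeta> w) = 0"
    by (simp_all add: AD_root_def)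
qed

lemma cmod_near_zeta:
  assumes "cmod (b - \<zeta>) < tube_radius N / 8"
  shows "1 / 2 \<le> cmod b" "cmod b \<le> 2" "b \<noteq> 0"
proof -
  show *: "1 / 2 \<le> cmod b" "cmod b \<le> 2"
    using assms tube_radius_le[OF one_le_N] cmod_zeta norm_triangle_ineq2[of b \<zeta>] norm_triangle_ineq2[of \<zeta> b]
    by (auto simp: norm_minus_commute)
  then show "b \<noteq> 0" by auto
qed

lemma small_root_coeffs:
  assumes w: "small_moduli N w"
  shows "small_coeffs N (root_coeffs N \<zeta> w)"
proof -
  have "(\<Sum>n=1..N - 2. cmod (root_coeffs N \<zeta> w n)) \<le> (\<Sum>n=1..N - 2. 1 / (16 * real N ^ 2 * 4 ^ N) * 2 ^ N)"
  proof (rule sum_mono)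
    fix n assume n: "n \<in> {1..N - 2}"
    have "cmod (root_coeffs N \<zeta> w n) = cmod (w n) * cmod (AD_root N \<zeta> w ^ n)"
      by (simp add: root_coeffs_def norm_mult)
    also have "\<dots> \<le> 1 / (16 * real N ^ 2 * 4 ^ N) * 2 ^ N"
    proof (rule mult_mono)
      have "cmod (w n) < moduli_radius N" using w n by (auto simp: small_moduli_def)
      then show "cmod (w n) \<le> 1 / (16 * real N ^ 2 * 4 ^ N)" by (simp add: moduli_radius_def)
      show "cmod (AD_root N \<zeta> w ^ n) \<le> 2 ^ N"
        using n cmod_near_zeta[OF AD_root_props(1)[OF w]] by (intro norm_power_le) auto
    qed auto
    finally show "cmod (root_coeffs N \<zeta> w n) \<le> 1 / (16 * real N ^ 2 * 4 ^ N) * 2 ^ N" .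
  qed
  also have "\<dots> \<le> real N * (1 / (16 * real N ^ 2 * 4 ^ N) * 2 ^ N)"
    by (simp add: divide_right_mono)
  also have "\<dots> = 1 / (16 * real N * 2 ^ N)"
    using N power_mult_distrib[of "2::real" 2 N] by (simp add: power2_eq_square)
  finally show ?thesis by (simp add: small_coeffs_def)
qed

lemma AD_poly_scaled:
  assumes "small_moduli N w"
  shows "poly (AD_poly N w) (AD_root N \<zeta> w * s) = reduced N (root_coeffs N \<zeta> w) s"
proof -
  define b where "b = AD_root N \<zeta> w"
  have "b ^ N - (\<Sum>n=1..N - 2. w n * b ^ n) + 1 = 0"
    using AD_root_props(2)[OF assms] by (simp add: poly_AD_poly b_def)
  then have b: "b ^ N = (\<Sum>n=1..N - 2. w n * b ^ n) - 1" by (simp add: algebra_simps)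
  show ?thesis
    unfolding reduced_eq poly_AD_poly root_coeffs_def b_def[symmetric] power_mult_distrib b
    by (simp add: algebra_simps sum_subtractf sum_distrib_left)
qed

lemma quotient_in_tube:
  assumes "cmod (\<beta> - \<zeta>) < \<rho>" "\<rho> \<le> tube_radius N / 8" "z \<in> tube \<rho> \<zeta>"
  shows "z / \<beta> \<in> tube (tube_radius N) 1"
proof -
  obtain \<sigma> where \<sigma>: "\<sigma> \<in> {0..1}" "cmod (z - of_real \<sigma> * \<zeta>) < \<rho>"
    using assms(3) by (auto simp: tube_def closed_segment_def scaleR_conv_of_real dist_norm norm_minus_commute)
  have \<beta>: "1 / 2 \<le> cmod \<beta>" "\<beta> \<noteq> 0" using cmod_near_zeta[of \<beta>] assms by auto
  have "z / \<beta> - of_real \<sigma> = ((z - of_real \<sigma> * \<zeta>) - of_real \<sigma> * (\<beta> - \<zeta>)) / \<beta>"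
    using \<beta> by (simp add: field_simps)
  also have "cmod \<dots> \<le> (\<rho> + 1 * \<rho>) / (1 / 2)"
    unfolding norm_divide
  proof (rule frac_le)
    have "cmod (of_real \<sigma> * (\<beta> - \<zeta>)) \<le> 1 * \<rho>"
      unfolding norm_mult using \<sigma> assms by (intro mult_mono) auto
    then show "cmod ((z - of_real \<sigma> * \<zeta>) - of_real \<sigma> * (\<beta> - \<zeta>)) \<le> \<rho> + 1 * \<rho>"
      using \<sigma> by (intro norm_triangle_le_diff) linarith
    show "0 \<le> \<rho> + 1 * \<rho>" using \<sigma>(2) norm_ge_zero[of "z - of_real \<sigma> * \<zeta>"] by linarith
  qed (use \<beta> in auto)
  also have "\<dots> < tube_radius N" using assms(2) tube_radius_pos[OF one_le_N] by simp
  finally have "cmod (of_real \<sigma> - z / \<beta>) < tube_radius N" by (simp add: norm_minus_commute)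
  moreover have "of_real \<sigma> \<in> closed_segment 0 (1::complex)"
    using \<sigma> by (auto simp: closed_segment_def scaleR_conv_of_real)
  ultimately show ?thesis by (auto simp: tube_def dist_norm)
qed

lemma segment_in_tube:
  assumes "cmod (\<beta> - \<zeta>) < \<rho>" "t \<in> {0..1}"
  shows "\<beta> * of_real t \<in> tube \<rho> \<zeta>"
proof -
  have "of_real t * \<zeta> - \<beta> * of_real t = - (of_real t * (\<beta> - \<zeta>))" by (simp add: algebra_simps)
  then have "dist (of_real t * \<zeta>) (\<beta> * of_real t) = t * cmod (\<beta> - \<zeta>)"
    using assms(2) by (simp add: dist_norm norm_mult)
  also have "\<dots> \<le> cmod (\<beta> - \<zeta>)" using assms(2) by (simp add: mult_left_le_one_le)
  finally have "\<beta> * of_real t \<in> ball (of_real t * \<zeta>) \<rho>" using assms by simp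
  moreover have "of_real t * \<zeta> \<in> closed_segment 0 \<zeta>"
    using assms(2) by (auto simp: closed_segment_def scaleR_conv_of_real)
  ultimately show ?thesis by (auto simp: tube_def)
qed

lemma reduced_eq_0_iff:
  assumes "s \<in> tube (tube_radius N) 1" "small_coeffs N a"
  shows "reduced N a s = 0 \<longleftrightarrow> s = 1"
  using Re_cofactor_ge[OF assms one_le_N] by (auto simp: reduced_def)

lemma AD_root_unique:
  assumes w: "small_moduli N w" and z: "cmod (z - \<zeta>) < tube_radius N / 8" "poly (AD_poly N w) z = 0"
  shows "z = AD_root N \<zeta> w"
proof -
  define b where "b = AD_root N \<zeta> w"
  note b = AD_root_props[OF w, folded b_def]
  have b0: "b \<noteq> 0" using cmod_near_zeta[OF b(1)] by auto
  have "z \<in> ball \<zeta> (tube_radius N / 8)" using z by (simp add: dist_norm norm_minus_commute)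
  then have "z \<in> tube (tube_radius N / 8) \<zeta>" using ball_subset_tube by blast
  then have "z / b \<in> tube (tube_radius N) 1" by (intro quotient_in_tube[OF b(1)]) auto
  moreover have "reduced N (root_coeffs N \<zeta> w) (z / b) = 0"
    using AD_poly_scaled[OF w, of "z / b"] z(2) b0 by (simp add: b_def)
  ultimately have "z / b = 1" using reduced_eq_0_iff small_root_coeffs[OF w] by blast
  then show ?thesis using b0 by (simp add: b_def)
qed

lemma AD_root_near:
  assumes w: "small_moduli N w" and \<rho>: "0 < \<rho>" "\<rho> \<le> tube_radius N / 8"
    and sum: "(\<Sum>n=1..N - 2. cmod (w n)) < \<rho> ^ N"
  shows "cmod (AD_root N \<zeta> w - \<zeta>) < \<rho>"
proof -
  obtain z where z: "cmod (z - \<zeta>) < \<rho>" "poly (AD_poly N w) z = 0"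
    using AD_poly_root_near[OF \<rho>(1) sum] by blast
  then show ?thesis using AD_root_unique[OF w, of z] \<rho> by auto
qed

lemma AD_root_holomorphic:
  fixes c :: "complex \<Rightarrow> nat \<Rightarrow> complex"
  assumes U: "open U" and c: "\<And>n. n \<in> {1..N - 2} \<Longrightarrow> (\<lambda>x. c x n) holomorphic_on U"
    and small: "\<And>x. x \<in> U \<Longrightarrow> small_moduli N (c x)"
  shows "(\<lambda>x. AD_root N \<zeta> (c x)) holomorphic_on U"
  unfolding holomorphic_on_open[OF U]
proof
  fix x assume x: "x \<in> U"
  define b where "b y = AD_root N \<zeta> (c y)" for y
  define a where "a = root_coeffs N \<zeta> (c x)"
  define E where "E y = (\<Sum>n=1..N - 2. (c y n - c x n) * b y ^ n)" for y
  have nz: "b y \<noteq> 0" "cmod (b y) \<le> 2" "cmod (b y - \<zeta>) < tube_radius N / 8" if "y \<in> U" for y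
    using AD_root_props(1)[OF small[OF that]] cmod_near_zeta[of "b y"] by (auto simp: b_def)
  have tube: "b y / b x \<in> tube (tube_radius N) 1" if "y \<in> U" for y
    using nz[OF that] nz[OF x] subsetD[OF ball_subset_tube, of "b y" \<zeta> "tube_radius N / 8"]
    by (intro quotient_in_tube[of _ "tube_radius N / 8"]) (auto simp: dist_norm norm_minus_commute)
  have cof: "1 / 2 \<le> cmod (cofactor N a (b y / b x))" if "y \<in> U" for y
    using Re_cofactor_ge[OF tube[OF that] small_root_coeffs[OF small[OF x]] one_le_N]
      complex_Re_le_cmod[of "cofactor N a (b y / b x)"] by (simp add: a_def)
  have diff: "b y - b x = - b x * E y / cofactor N a (b y / b x)" if y: "y \<in> U" for y
  proof -
    have "(1 - b y / b x) * cofactor N a (b y / b x) = poly (AD_poly N (c x)) (b y)"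
      using AD_poly_scaled[OF small[OF x], of "b y / b x"] nz[OF x]
      by (simp add: reduced_def a_def b_def)
    also have "\<dots> = poly (AD_poly N (c x)) (b y) - poly (AD_poly N (c y)) (b y)"
      using AD_root_props(2)[OF small[OF y]] by (simp add: b_def)
    also have "\<dots> = E y"
      by (simp add: poly_AD_poly E_def left_diff_distrib sum_subtractf)
    finally have "1 - b y / b x = E y / cofactor N a (b y / b x)"
      using cof[OF y] by (subst nonzero_eq_divide_eq) auto
    then have "b x * (1 - b y / b x) = b x * (E y / cofactor N a (b y / b x))" by simp
    then show ?thesis using nz[OF x] by (simp add: right_diff_distrib minus_equation_iff[of "b x"] algebra_simps)
  qed
  have evU: "\<forall>\<^sub>F y in at x. y \<in> U" using U x by (rule eventually_at_in_open')
  have cl: "((\<lambda>y. c y n - c x n) \<longlongrightarrow> 0) (at x)" if "n \<in> {1..N - 2}" for n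
  proof -
    have "isCont (\<lambda>y. c y n) x"
      using holomorphic_on_imp_continuous_on[OF c[OF that]] U x
      by (simp add: continuous_on_eq_continuous_at)
    then show ?thesis by (simp add: isCont_def LIM_zero)
  qed
  have b_lim: "(b \<longlongrightarrow> b x) (at x)"
  proof (rule LIM_zero_cancel, rule Lim_null_comparison)
    show "\<forall>\<^sub>F y in at x. norm (b y - b x) \<le> 2 * (\<Sum>n=1..N - 2. cmod (c y n - c x n) * 2 ^ N) / (1 / 2)"
      using evU
    proof eventually_elim
      case (elim y)
      have "cmod (E y) \<le> (\<Sum>n=1..N - 2. cmod (c y n - c x n) * 2 ^ N)"
        unfolding E_def
        by (rule sum_norm_le) (use nz[OF elim] in \<open>auto simp: norm_mult intro!: mult_left_mono norm_power_le\<close>)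
      then show ?case
        unfolding diff[OF elim] norm_divide norm_mult norm_minus_cancel
        using cof[OF elim] nz[OF x] by (intro frac_le mult_mono) (auto intro!: sum_nonneg)
    qed
    have "((\<lambda>y. 2 * (\<Sum>n=1..N - 2. cmod (c y n - c x n) * 2 ^ N) / (1 / 2)) \<longlongrightarrow>
        2 * (\<Sum>n=1..N - 2. cmod 0 * 2 ^ N) / (1 / 2)) (at x)"
      by (intro tendsto_intros cl) auto
    then show "((\<lambda>y. 2 * (\<Sum>n=1..N - 2. cmod (c y n - c x n) * 2 ^ N) / (1 / 2)) \<longlongrightarrow> 0) (at x)"
      by simp
  qed
  have cof_cont: "isCont (cofactor N a) 1"
    unfolding cofactor_def by (intro continuous_intros)
  have "((\<lambda>y. b y / b x) \<longlongrightarrow> b x / b x) (at x)"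
    using nz[OF x] by (intro tendsto_intros b_lim) auto
  then have cof_lim: "((\<lambda>y. cofactor N a (b y / b x)) \<longlongrightarrow> cofactor N a 1) (at x)"
    using nz[OF x] isCont_tendsto_compose[OF cof_cont] by simp
  have cof1: "cofactor N a 1 \<noteq> 0" using cof[OF x] nz[OF x] by auto
  have "((\<lambda>y. - b x * (\<Sum>n=1..N - 2. ((c y n - c x n) / (y - x)) * b y ^ n) / cofactor N a (b y / b x)) \<longlongrightarrow>
      - b x * (\<Sum>n=1..N - 2. deriv (\<lambda>y. c y n) x * b x ^ n) / cofactor N a 1) (at x)"
  proof (intro tendsto_intros b_lim cof_lim cof1)
    fix n assume "n \<in> {1..N - 2}"
    then show "((\<lambda>y. (c y n - c x n) / (y - x)) \<longlongrightarrow> deriv (\<lambda>y. c y n) x) (at x)"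
      using holomorphic_derivI[OF c U x] unfolding has_field_derivative_iff by simp
  qed
  then have "((\<lambda>y. (b y - b x) / (y - x)) \<longlongrightarrow>
      - b x * (\<Sum>n=1..N - 2. deriv (\<lambda>y. c y n) x * b x ^ n) / cofactor N a 1) (at x)"
  proof (rule Lim_transform_eventually)
    show "\<forall>\<^sub>F y in at x. - b x * (\<Sum>n=1..N - 2. ((c y n - c x n) / (y - x)) * b y ^ n) / cofactor N a (b y / b x)
        = (b y - b x) / (y - x)"
      using evU
    proof eventually_elim
      case (elim y)
      have "(\<Sum>n=1..N - 2. ((c y n - c x n) / (y - x)) * b y ^ n) = E y / (y - x)"
        by (simp add: E_def sum_divide_distrib)
      then show ?case by (simp add: diff[OF elim])
    qed
  qed
  then show "\<exists>f'. ((\<lambda>x. AD_root N \<zeta> (c x)) has_field_derivative f') (at x)"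
    unfolding has_field_derivative_iff b_def by blast
qed

end

section \<open>The functions Q and R\<close>

definition AD_period :: "nat \<Rightarrow> complex \<Rightarrow> complex \<Rightarrow> (nat \<Rightarrow> complex) \<Rightarrow> complex" where
  "AD_period N \<zeta> v w =
     2 * (v powr (1 / of_nat N) * AD_root N \<zeta> w) * v * csqrt (2 - v) / (of_real pi * csqrt (v * (2 - v)))
       * period N v (root_coeffs N \<zeta> w)"

definition AD_coords :: "nat \<Rightarrow> (nat \<Rightarrow> complex) \<Rightarrow> nat \<Rightarrow> complex" where
  "AD_coords N u n = u n / (1 - u 0) powr (1 - of_nat n / of_nat N)"

definition SW_period :: "nat \<Rightarrow> complex \<Rightarrow> (nat \<Rightarrow> complex) \<Rightarrow> complex" where
  "SW_period N \<zeta> u = AD_period N \<zeta> (1 - u 0) (AD_coords N u)"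

lemma SW_poly_AD_coords:
  assumes "u 0 \<noteq> 1"
  shows "SW_poly N (AD_moduli N (1 - u 0) (AD_coords N u)) = SW_poly N u"
  using assms by (auto simp: SW_poly_def AD_moduli_def AD_coords_def intro!: sum.cong)

lemma valid_path_segment: "valid_path (\<lambda>t. b * complex_of_real t)"
proof -
  have "linepath 0 b = (\<lambda>t. b * complex_of_real t)"
    by (rule ext) (simp add: linepath_def scaleR_conv_of_real)
  then show ?thesis by (metis valid_path_linepath)
qed

lemma poly_SW_poly: "poly (SW_poly N u) x = x ^ N - (\<Sum>n\<le>N - 2. u n * x ^ n)"
  by (simp add: SW_poly_def poly_sum poly_monom)

lemma order_eq_1:
  fixes p :: "complex poly"
  assumes "poly p x = 0" "poly (pderiv p) x \<noteq> 0"
  shows "order x p = 1"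
proof -
  have "p \<noteq> 0" using assms(2) by auto
  then have "order x p = Suc (order x (pderiv p))" using assms(1) by (rule order_pderiv)
  then show ?thesis using assms(2) by (simp add: order_0I)
qed

lemma cmod_powr_ge:
  fixes v :: complex
  assumes "n \<le> N" "0 < c" "c \<le> 1" "c \<le> cmod v"
  shows "c \<le> cmod (v powr (1 - of_nat n / of_nat N))"
proof -
  define p where "p = 1 - real n / real N"
  have p: "0 \<le> p" "p \<le> 1" using assms(1) by (auto simp: p_def divide_le_eq)
  have "c = c powr 1" using assms by simp
  also have "\<dots> \<le> c powr p" using assms p by (intro powr_mono') auto
  also have "\<dots> \<le> cmod v powr p" using assms p by (intro powr_mono2) auto
  also have "\<dots> = cmod (v powr (1 - of_nat n / of_nat N))"
    using norm_powr_real_powr'[of "1 - of_nat n / of_nat N" v] by (simp add: p_def)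
  finally show ?thesis .
qed

context
  fixes N :: nat and \<zeta> :: complex
  assumes N: "3 \<le> N" and \<zeta>: "\<zeta> ^ N = -1"
begin

lemma powr_root_power:
  assumes "v \<noteq> 0"
  shows "v powr (1 - of_nat n / of_nat N) * (v powr (1 / of_nat N)) ^ n = (v :: complex)"
    and "(v powr (1 / of_nat N)) ^ N = v"
proof -
  have p: "(v powr (1 / of_nat N)) ^ n = exp (of_nat n / of_nat N * Ln v)" for n
    using assms by (simp add: powr_def exp_of_nat_mult[symmetric])
  show "v powr (1 - of_nat n / of_nat N) * (v powr (1 / of_nat N)) ^ n = v"
    unfolding p using assms by (simp add: powr_def exp_add[symmetric] algebra_simps)
  show "(v powr (1 / of_nat N)) ^ N = v" using assms N by (simp add: p)
qed

lemma SW_poly_AD_poly: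
  assumes "v \<noteq> 0"
  shows "poly (SW_poly N (AD_moduli N v w)) (v powr (1 / of_nat N) * z) = v * poly (AD_poly N w) z - 1"
proof -
  define \<kappa> where "\<kappa> = v powr (1 / of_nat N)"
  have I: "{..N - 2} = insert 0 {1..N - 2}" by auto
  have "(\<Sum>n=1..N - 2. AD_moduli N v w n * (\<kappa> * z) ^ n) = (\<Sum>n=1..N - 2. v * (w n * z ^ n))"
  proof (rule sum.cong)
    fix n assume "n \<in> {1..N - 2}"
    then have "AD_moduli N v w n * (\<kappa> * z) ^ n =
        (v powr (1 - of_nat n / of_nat N) * \<kappa> ^ n) * (w n * z ^ n)"
      by (simp add: AD_moduli_def power_mult_distrib mult_ac)
    then show "AD_moduli N v w n * (\<kappa> * z) ^ n = v * (w n * z ^ n)"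
      unfolding \<kappa>_def powr_root_power(1)[OF assms] .
  qed simp
  then have "poly (SW_poly N (AD_moduli N v w)) (\<kappa> * z) =
      (\<kappa> * z) ^ N - (1 - v) - (\<Sum>n=1..N - 2. v * (w n * z ^ n))"
    unfolding poly_SW_poly I by (simp add: AD_moduli_def)
  then show ?thesis
    using powr_root_power(2)[OF assms]
    by (simp add: \<kappa>_def poly_AD_poly power_mult_distrib algebra_simps sum_distrib_left)
qed

context
  fixes v :: complex and w u :: "nat \<Rightarrow> complex" and \<beta> :: complex
  assumes w: "small_moduli N w" and v: "v \<noteq> 0" "cmod v < 4 / 3"
    and u: "SW_poly N u = SW_poly N (AD_moduli N v w)"
    and \<beta>: "\<beta> = v powr (1 / of_nat N) * AD_root N \<zeta> w"
begin

lemma scaled_coeffs_small: "small_coeffs N (root_coeffs N \<zeta> w)"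
  by (rule small_root_coeffs[OF N \<zeta> w])

lemma branch_point_nonzero: "\<beta> \<noteq> 0"
  using v cmod_near_zeta(3)[OF N \<zeta> AD_root_props(1)[OF N \<zeta> w]] by (simp add: \<beta>)

lemma SW_poly_scaled: "poly (SW_poly N u) (\<beta> * s) = v * reduced N (root_coeffs N \<zeta> w) s - 1"
  using SW_poly_AD_poly[OF v(1), of w "AD_root N \<zeta> w * s"] AD_poly_scaled[OF N \<zeta> w, of s]
  by (simp add: u \<beta> mult.assoc)

lemma SW_integral_eq:
  assumes \<gamma>: "valid_path \<gamma>" "pathstart \<gamma> = 0" "pathfinish \<gamma> = \<beta>"
      "\<And>t. t \<in> {0..1} \<Longrightarrow> \<gamma> t / \<beta> \<in> tube (tube_radius N) 1"
    and Y: "SW_lift N u \<gamma> Y" "Y 0 = - \<i> * csqrt (v * (2 - v))"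
  shows "SW_integral N u \<gamma> Y (\<i> * of_real pi * q) \<longleftrightarrow> q = AD_period N \<zeta> v w"
proof -
  have "((\<lambda>t. \<gamma> t * poly (pderiv (SW_poly N u)) (\<gamma> t) / Y t * vector_derivative \<gamma> (at t within {0..1}))
      has_integral 2 * \<beta> * v * csqrt (2 - v) / Y 0 * period N v (root_coeffs N \<zeta> w)) {0..1}"
    by (rule lifted_integral[OF one_le_N[OF N \<zeta>] scaled_coeffs_small v(2) branch_point_nonzero SW_poly_scaled \<gamma>])
       (use Y(1) in \<open>auto simp: SW_lift_def\<close>)
  also have "2 * \<beta> * v * csqrt (2 - v) / Y 0 * period N v (root_coeffs N \<zeta> w) =
      \<i> * of_real pi * AD_period N \<zeta> v w"
  proof -
    define c where "c = csqrt (v * (2 - v))"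
    have "c \<noteq> 0" using v by (auto simp: c_def)
    then show ?thesis
      unfolding AD_period_def \<beta> Y(2) c_def[symmetric] by (simp add: divide_simps)
  qed
  finally have I: "SW_integral N u \<gamma> Y (\<i> * of_real pi * AD_period N \<zeta> v w)"
    by (simp add: SW_integral_def)
  show ?thesis
  proof
    assume "SW_integral N u \<gamma> Y (\<i> * of_real pi * q)"
    then have "\<i> * of_real pi * q = \<i> * of_real pi * AD_period N \<zeta> v w"
      using I unfolding SW_integral_def by (rule has_integral_unique)
    then show "q = AD_period N \<zeta> v w" by simp
  qed (use I in simp)
qed

lemma SW_lift_segment:
  obtains Y where "SW_lift N u (\<lambda>t. \<beta> * of_real t) Y" "Y 0 = - \<i> * csqrt (v * (2 - v))"
proof (rule segment_lift[OF one_le_N[OF N \<zeta>] scaled_coeffs_small v(2) branch_point_nonzero SW_poly_scaled v(1)])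
  fix Y assume Y: "continuous_on {0..1} Y"
    "\<And>t. t \<in> {0..1} \<Longrightarrow> (Y t)\<^sup>2 = (poly (SW_poly N u) (\<beta> * of_real t))\<^sup>2 - 1"
    "\<And>t. t \<in> {0..<1} \<Longrightarrow> Y t \<noteq> 0" "Y 0 = - \<i> * csqrt (v * (2 - v))"
  have "SW_lift N u (\<lambda>t. \<beta> * of_real t) Y"
    unfolding SW_lift_def using Y(1-3) by auto
  then show thesis using Y(4) by (rule that)
qed

lemma SW_branch_point_iff:
  assumes s: "s \<in> tube (tube_radius N) 1"
  shows "SW_branch_point N u (\<beta> * s) \<longleftrightarrow> s = 1"
proof -
  define a where "a = root_coeffs N \<zeta> w"
  define q where "q = (SW_poly N u)\<^sup>2 - 1"
  have q: "poly q (\<beta> * s) = v * reduced N a s * (v * reduced N a s - 2)" for s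
    by (simp add: q_def SW_poly_scaled a_def power2_eq_square algebra_simps)
  have r0: "reduced N a s = 0 \<longleftrightarrow> s = 1" if "s \<in> tube (tube_radius N) 1" for s
    using reduced_eq_0_iff[OF N \<zeta> that] scaled_coeffs_small by (simp add: a_def)
  have nz: "v * reduced N a s - 2 \<noteq> 0" if "s \<in> tube (tube_radius N) 1" for s
  proof
    assume "v * reduced N a s - 2 = 0"
    then have "2 - v * reduced N a s = 0" by simp
    then show False using Re_two_minus_ge[OF that scaled_coeffs_small one_le_N[OF N \<zeta>] v(2)] by (simp only: a_def) simp
  qed
  have one: "1 \<in> tube (tube_radius N) 1" using of_real_in_tube_1[of 1 "tube_radius N"] tube_radius_pos[OF one_le_N[OF N \<zeta>]] by simp
  show ?thesis
  proof (cases "s = 1")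
    case True
    have "poly q \<beta> = 0" using q[of 1] by (simp add: reduced_def)
    moreover have "poly (pderiv q) \<beta> \<noteq> 0"
    proof -
      have "\<beta> * poly (pderiv (SW_poly N u)) (\<beta> * 1) = v * reduced_deriv N a 1"
        unfolding a_def
        by (rule pderiv_scaled[OF one_le_N[OF N \<zeta>] scaled_coeffs_small v(2) branch_point_nonzero SW_poly_scaled])
      moreover have "cofactor N a 1 \<noteq> 0"
        using Re_cofactor_ge[OF one scaled_coeffs_small one_le_N[OF N \<zeta>]] by (auto simp: a_def)
      moreover have "poly (SW_poly N u) \<beta> = - 1"
        using SW_poly_scaled[of 1] by (simp add: reduced_def)
      moreover have "poly (pderiv q) \<beta> = 2 * poly (SW_poly N u) \<beta> * poly (pderiv (SW_poly N u)) \<beta>"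
        by (simp add: q_def power2_eq_square pderiv_diff pderiv_mult pderiv_1)
      ultimately show ?thesis using v by (auto simp: reduced_deriv_def)
    qed
    ultimately have "order \<beta> q = 1" by (rule order_eq_1)
    then show ?thesis using True by (simp add: SW_branch_point_def q_def)
  next
    case False
    then have "poly q (\<beta> * s) \<noteq> 0" using q[of s] r0[OF s] nz[OF s] v by simp
    then have "order (\<beta> * s) q = 0" by (rule order_0I)
    then show ?thesis using False by (simp add: SW_branch_point_def q_def)
  qed
qed

end

lemma near_segment_segment:
  assumes "cmod (\<beta> - \<zeta>) < \<rho>"
  shows "near_segment \<rho> \<zeta> \<beta> (\<lambda>t. \<beta> * of_real t)"
  using segment_in_tube[OF N \<zeta> assms] valid_path_segment
  by (auto simp: near_segment_def path_image_def pathstart_def pathfinish_def)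

lemma is_R_AD_period: "is_R N \<zeta> (AD_period N \<zeta>)"
  unfolding is_R_def
proof (rule exI[of _ "tube_radius N / 8"], intro conjI ballI)
  have one_le_N: "N \<ge> 1" using N by simp
  show "tube_radius N / 8 > 0" using tube_radius_pos[OF one_le_N] by simp
  fix \<rho> assume "\<rho> \<in> {0<..tube_radius N / 8}"
  then have \<rho>: "0 < \<rho>" "\<rho> \<le> tube_radius N / 8" by auto
  define e where "e = min 1 (min (moduli_radius N) (\<rho> ^ N / real N))"
  have e: "e > 0" using moduli_radius_pos[OF N \<zeta>] \<rho> N by (simp add: e_def)
  show "\<exists>\<epsilon>>0. \<forall>v w. 0 < cmod v \<and> cmod v < \<epsilon> \<and> (\<forall>n\<in>{1..N - 2}. cmod (w n) < \<epsilon>) \<longrightarrow>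
        (\<forall>r. R_value N \<rho> \<zeta> v w r \<longleftrightarrow> r = AD_period N \<zeta> v w)"
  proof (intro exI[of _ e] conjI allI impI e)
    fix v r :: complex and w :: "nat \<Rightarrow> complex"
    assume "0 < cmod v \<and> cmod v < e \<and> (\<forall>n\<in>{1..N - 2}. cmod (w n) < e)"
    then have v: "v \<noteq> 0" "cmod v < 4 / 3" and wb: "\<And>n. n \<in> {1..N - 2} \<Longrightarrow> cmod (w n) < e"
      by (auto simp: e_def)
    have w: "small_moduli N w" using wb by (force simp: small_moduli_def e_def)
    have sum: "(\<Sum>n=1..N - 2. cmod (w n)) < \<rho> ^ N"
      by (rule sum_lt_if_bounded[OF N \<zeta> wb e]) (simp_all add: e_def)
    define b where "b = AD_root N \<zeta> w"
    have b: "cmod (b - \<zeta>) < \<rho>"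
      unfolding b_def by (rule AD_root_near[OF N \<zeta> w \<rho> sum])
    define \<kappa> where "\<kappa> = v powr (1 / of_nat N)"
    have \<kappa>: "\<kappa> \<noteq> 0" using v by (simp add: \<kappa>_def)
    have roots: "{z \<in> ball \<zeta> \<rho>. poly (AD_poly N w) z = 0} = {b}"
      using AD_root_props(2)[OF N \<zeta> w] b AD_root_unique[OF N \<zeta> w] \<rho>
      by (force simp: b_def dist_norm norm_minus_commute)
    have eq: "SW_integral N (AD_moduli N v w) (\<lambda>t. \<kappa> * \<gamma> t) Y (\<i> * of_real pi * q)
        \<longleftrightarrow> q = AD_period N \<zeta> v w"
      if \<gamma>: "near_segment \<rho> \<zeta> b \<gamma>" and Y: "SW_lift N (AD_moduli N v w) (\<lambda>t. \<kappa> * \<gamma> t) Y"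
        "Y 0 = - \<i> * csqrt (v * (2 - v))" for \<gamma> Y q
    proof (rule SW_integral_eq[OF w v refl refl])
      show "valid_path (\<lambda>t. \<kappa> * \<gamma> t)" "pathstart (\<lambda>t. \<kappa> * \<gamma> t) = 0"
        "pathfinish (\<lambda>t. \<kappa> * \<gamma> t) = v powr (1 / of_nat N) * AD_root N \<zeta> w"
        using \<gamma> by (auto simp: near_segment_def pathstart_def pathfinish_def \<kappa>_def b_def
            intro: valid_path_cmult)
      fix t :: real assume "t \<in> {0..1}"
      then have "\<gamma> t \<in> tube \<rho> \<zeta>" using \<gamma> by (auto simp: near_segment_def path_image_def)
      then have "\<gamma> t / b \<in> tube (tube_radius N) 1" by (rule quotient_in_tube[OF N \<zeta> b \<rho>(2)])
      then show "\<kappa> * \<gamma> t / (v powr (1 / of_nat N) * AD_root N \<zeta> w) \<in> tube (tube_radius N) 1"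
        using \<kappa> by (simp add: b_def \<kappa>_def[symmetric])
    qed (use Y in auto)
    show "R_value N \<rho> \<zeta> v w r \<longleftrightarrow> r = AD_period N \<zeta> v w"
    proof
      assume "R_value N \<rho> \<zeta> v w r"
      then obtain b' \<gamma> Y where R: "{z \<in> ball \<zeta> \<rho>. poly (AD_poly N w) z = 0} = {b'}"
          "near_segment \<rho> \<zeta> b' \<gamma>" "SW_lift N (AD_moduli N v w) (\<lambda>t. \<kappa> * \<gamma> t) Y"
          "Y 0 = - \<i> * csqrt (v * (2 - v))"
          "SW_integral N (AD_moduli N v w) (\<lambda>t. \<kappa> * \<gamma> t) Y (\<i> * of_real pi * r)"
        unfolding R_value_def Let_def \<kappa>_def[symmetric] by blast
      then have "b' = b" using roots by simp
      then show "r = AD_period N \<zeta> v w" using eq[of \<gamma> Y r] R by simp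
    next
      assume r: "r = AD_period N \<zeta> v w"
      obtain Y where Y: "SW_lift N (AD_moduli N v w) (\<lambda>t. \<kappa> * b * of_real t) Y"
          "Y 0 = - \<i> * csqrt (v * (2 - v))"
        unfolding \<kappa>_def b_def by (rule SW_lift_segment[OF w v refl refl])
      have \<gamma>: "near_segment \<rho> \<zeta> b (\<lambda>t. b * of_real t)" by (rule near_segment_segment[OF b])
      have Y': "SW_lift N (AD_moduli N v w) (\<lambda>t. \<kappa> * (b * of_real t)) Y"
        using Y(1) by (simp add: mult.assoc)
      show "R_value N \<rho> \<zeta> v w r"
        unfolding R_value_def Let_def \<kappa>_def[symmetric]
        by (intro exI conjI, rule roots, rule \<gamma>, rule Y', rule Y(2))
           (use eq[OF \<gamma> Y' Y(2)] r in blast)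
    qed
  qed
qed

lemma powr_near_1:
  assumes "0 < (e::real)"
  shows "\<exists>d>0. \<forall>v::complex. cmod (v - 1) < d \<longrightarrow> cmod (v powr (1 / of_nat N) - 1) < e"
proof -
  have "isCont (\<lambda>v::complex. v powr (1 / of_nat N)) 1"
    by (intro continuous_intros) auto
  then show ?thesis
    using assms unfolding continuous_at_eps_delta dist_norm by (metis powr_one_eq_one)
qed

lemma is_Q_SW_period: "is_Q N \<zeta> (SW_period N \<zeta>)"
  unfolding is_Q_def
proof (rule exI[of _ "tube_radius N / 8"], intro conjI ballI)
  have one_le_N: "N \<ge> 1" using N by simp
  show "tube_radius N / 8 > 0" using tube_radius_pos[OF one_le_N] by simp
  fix \<rho> assume "\<rho> \<in> {0<..tube_radius N / 8}"
  then have \<rho>: "0 < \<rho>" "\<rho> \<le> tube_radius N / 8" by auto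
  define \<eta> where "\<eta> = min (moduli_radius N) ((\<rho> / 4) ^ N / real N)"
  have \<eta>: "\<eta> > 0" using moduli_radius_pos[OF N \<zeta>] \<rho> N by (simp add: \<eta>_def)
  obtain d where d: "d > 0" "\<And>v::complex. cmod (v - 1) < d \<Longrightarrow> cmod (v powr (1 / of_nat N) - 1) < \<rho> / 4"
    using powr_near_1[of "\<rho> / 4"] \<rho> by auto
  define e where "e = min (1 / 4) (min d (\<eta> / 2))"
  have e: "e > 0" using d \<eta> by (simp add: e_def)
  show "\<exists>\<epsilon>>0. \<forall>u\<in>polydisc N (\<lambda>_. 0) \<epsilon>. \<forall>q. Q_value N \<rho> \<zeta> u q \<longleftrightarrow> q = SW_period N \<zeta> u"
  proof (intro exI[of _ e] conjI ballI allI impI e)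
    fix u and q :: complex assume "u \<in> polydisc N (\<lambda>_. 0) e"
    then have un: "\<And>n. n \<le> N - 2 \<Longrightarrow> cmod (u n) < e" by (simp add: polydisc_def)
    define v where "v = 1 - u 0"
    define w where "w = AD_coords N u"
    have u0: "cmod (u 0) < e" using un by simp
    have v1: "cmod (v - 1) < d" "1 / 2 \<le> cmod v" "cmod v < 4 / 3" "v \<noteq> 0"
    proof -
      show "cmod (v - 1) < d" using u0 by (simp add: v_def e_def)
      show "1 / 2 \<le> cmod v" using u0 norm_triangle_ineq2[of 1 "u 0"] by (simp add: v_def e_def)
      then show "v \<noteq> 0" by auto
      show "cmod v < 4 / 3" using u0 norm_triangle_ineq4[of 1 "u 0"] by (simp add: v_def e_def)
    qed
    have wb: "cmod (w n) < \<eta>" if n: "n \<in> {1..N - 2}" for n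
    proof -
      have "1 / 2 \<le> cmod (v powr (1 - of_nat n / of_nat N))"
        by (rule cmod_powr_ge) (use n v1 in auto)
      moreover have "cmod (u n) < \<eta> / 2" using un[of n] n by (simp add: e_def)
      moreover have "\<eta> * (1 / 2) \<le> \<eta> * cmod (v powr (1 - of_nat n / of_nat N))"
        using \<eta> calculation by (intro mult_left_mono) auto
      ultimately have "cmod (u n) < \<eta> * cmod (v powr (1 - of_nat n / of_nat N))" by linarith
      then show ?thesis
        using v1 by (simp add: w_def AD_coords_def v_def[symmetric] norm_divide divide_less_eq)
    qed
    have w: "small_moduli N w" using wb by (force simp: small_moduli_def \<eta>_def)
    have sum: "(\<Sum>n=1..N - 2. cmod (w n)) < (\<rho> / 4) ^ N"
      by (rule sum_lt_if_bounded[OF N \<zeta> wb \<eta>]) (simp_all add: \<eta>_def)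
    define b where "b = AD_root N \<zeta> w"
    have b: "cmod (b - \<zeta>) < \<rho> / 4"
      unfolding b_def by (rule AD_root_near[OF N \<zeta> w _ _ sum]) (use \<rho> in auto)
    define \<kappa> where "\<kappa> = v powr (1 / of_nat N)"
    have \<kappa>: "cmod (\<kappa> - 1) < \<rho> / 4" unfolding \<kappa>_def by (rule d(2)[OF v1(1)])
    have \<kappa>2: "cmod \<kappa> \<le> 2"
      using \<kappa> \<rho> tube_radius_le[OF one_le_N] norm_triangle_ineq2[of \<kappa> 1] by simp
    define \<beta> where "\<beta> = \<kappa> * b"
    have "\<beta> - \<zeta> = \<kappa> * (b - \<zeta>) + (\<kappa> - 1) * \<zeta>" by (simp add: \<beta>_def algebra_simps)
    also have "cmod \<dots> \<le> cmod \<kappa> * cmod (b - \<zeta>) + cmod (\<kappa> - 1) * cmod \<zeta>"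
      by (metis norm_mult norm_triangle_ineq)
    also have "\<dots> \<le> 2 * (\<rho> / 4) + \<rho> / 4 * 1"
      using \<kappa>2 b \<kappa> cmod_zeta[OF N \<zeta>] \<rho> by (intro add_mono mult_mono) auto
    also have "\<dots> < \<rho>" using \<rho> by simp
    finally have \<beta>: "cmod (\<beta> - \<zeta>) < \<rho>" .
    have u: "SW_poly N u = SW_poly N (AD_moduli N v w)"
      unfolding v_def w_def by (rule SW_poly_AD_coords[symmetric]) (use v1(4) in \<open>auto simp: v_def\<close>)
    have \<beta>eq: "\<beta> = v powr (1 / of_nat N) * AD_root N \<zeta> w" by (simp add: \<beta>_def \<kappa>_def b_def)
    note ctx = w v1(4) v1(3) u \<beta>eq
    have nz: "\<beta> \<noteq> 0" by (rule branch_point_nonzero[OF ctx])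
    have vu: "1 - (u 0)\<^sup>2 = v * (2 - v)" by (simp add: v_def algebra_simps power2_eq_square)
    have bp: "SW_branch_point N u x \<longleftrightarrow> x = \<beta>" if x: "x \<in> ball \<zeta> \<rho>" for x
    proof -
      have "x / \<beta> \<in> tube (tube_radius N) 1"
        using quotient_in_tube[OF N \<zeta> \<beta> \<rho>(2)] ball_subset_tube x by blast
      from SW_branch_point_iff[OF ctx this] show ?thesis using nz by auto
    qed
    have set: "{x \<in> ball \<zeta> \<rho>. SW_branch_point N u x} = {\<beta>}"
    proof -
      have "\<beta> \<in> ball \<zeta> \<rho>" using \<beta> by (simp add: dist_norm norm_minus_commute)
      then show ?thesis using bp by blast
    qed
    have eq: "SW_integral N u \<gamma> Y (\<i> * of_real pi * q) \<longleftrightarrow> q = SW_period N \<zeta> u"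
      if \<gamma>: "near_segment \<rho> \<zeta> \<beta> \<gamma>" and Y: "SW_lift N u \<gamma> Y" "Y 0 = - \<i> * csqrt (1 - (u 0)\<^sup>2)" for \<gamma> Y q
      unfolding SW_period_def v_def[symmetric] w_def[symmetric]
    proof (rule SW_integral_eq[OF ctx])
      show "valid_path \<gamma>" "pathstart \<gamma> = 0" "pathfinish \<gamma> = \<beta>"
        using \<gamma> by (auto simp: near_segment_def)
      fix t :: real assume "t \<in> {0..1}"
      then have "\<gamma> t \<in> tube \<rho> \<zeta>" using \<gamma> by (auto simp: near_segment_def path_image_def)
      then show "\<gamma> t / \<beta> \<in> tube (tube_radius N) 1" by (rule quotient_in_tube[OF N \<zeta> \<beta> \<rho>(2)])
    qed (use Y vu in auto)
    show "Q_value N \<rho> \<zeta> u q \<longleftrightarrow> q = SW_period N \<zeta> u"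
    proof
      assume "Q_value N \<rho> \<zeta> u q"
      then show "q = SW_period N \<zeta> u" unfolding Q_value_def set using eq by auto
    next
      assume q: "q = SW_period N \<zeta> u"
      obtain Y where Y: "SW_lift N u (\<lambda>t. \<beta> * of_real t) Y" "Y 0 = - \<i> * csqrt (v * (2 - v))"
        by (rule SW_lift_segment[OF ctx])
      have \<gamma>: "near_segment \<rho> \<zeta> \<beta> (\<lambda>t. \<beta> * of_real t)" by (rule near_segment_segment[OF \<beta>])
      have Y0: "Y 0 = - \<i> * csqrt (1 - (u 0)\<^sup>2)" unfolding vu by (rule Y(2))
      show "Q_value N \<rho> \<zeta> u q"
        unfolding Q_value_def
        by (intro exI conjI, rule set, rule \<gamma>, rule Y(1), rule Y0)
           (use eq[OF \<gamma> Y(1) Y0] q in blast)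
    qed
  qed
qed

end

section \<open>Holomorphy and continuation\<close>

lemma period_cong:
  assumes "\<And>n. n \<in> {1..N - 2} \<Longrightarrow> a n = a' n"
  shows "period N v a = period N v a'"
proof -
  have "cofactor N a = cofactor N a'" "cofactor_deriv N a = cofactor_deriv N a'"
    unfolding cofactor_def cofactor_deriv_def using assms by (intro ext arg_cong2[of _ _ _ _ minus] sum.cong; simp)+
  then show ?thesis
    unfolding period_def integrand_def reduced_def reduced_deriv_def by simp
qed

lemma AD_period_cong:
  assumes "\<And>n. n \<in> {1..N - 2} \<Longrightarrow> w n = w' n"
  shows "AD_period N \<zeta> v w = AD_period N \<zeta> v w'"
proof -
  have "AD_poly N w = AD_poly N w'"
    unfolding AD_poly_def using assms by (intro arg_cong2[of _ _ _ _ plus] arg_cong2[of _ _ _ _ minus] sum.cong) auto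
  then have "AD_root N \<zeta> w = AD_root N \<zeta> w'" by (simp add: AD_root_def)
  moreover from this have "period N v (root_coeffs N \<zeta> w) = period N v (root_coeffs N \<zeta> w')"
    using assms by (intro period_cong) (simp add: root_coeffs_def)
  ultimately show ?thesis by (simp add: AD_period_def)
qed

lemma SW_period_cong:
  assumes "\<And>n. n \<le> N - 2 \<Longrightarrow> u n = u' n"
  shows "SW_period N \<zeta> u = SW_period N \<zeta> u'"
proof -
  have "u 0 = u' 0" by (rule assms) simp
  then show ?thesis
    unfolding SW_period_def using assms by (auto simp: AD_coords_def intro!: AD_period_cong)
qed

lemma SW_period_AD_moduli:
  assumes "v \<noteq> 0"
  shows "SW_period N \<zeta> (AD_moduli N v w) = AD_period N \<zeta> v w"
proof -
  have "1 - AD_moduli N v w 0 = v" by (simp add: AD_moduli_def)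
  moreover have "AD_period N \<zeta> v (AD_coords N (AD_moduli N v w)) = AD_period N \<zeta> v w"
    by (rule AD_period_cong) (use assms in \<open>auto simp: AD_coords_def AD_moduli_def\<close>)
  ultimately show ?thesis by (simp add: SW_period_def)
qed

lemma polydisc_open:
  assumes "u \<in> polydisc N c R"
  obtains s where "s > 0" "polydisc N u s \<subseteq> polydisc N c R"
proof
  define s where "s = Min ((\<lambda>n. R - dist (c n) (u n)) ` {..N - 2})"
  show "s > 0" unfolding s_def using assms by (subst Min_gr_iff) (auto simp: polydisc_def)
  have le: "s \<le> R - dist (c n) (u n)" if "n \<le> N - 2" for n
    unfolding s_def using that by (intro Min_le) auto
  show "polydisc N u s \<subseteq> polydisc N c R"
  proof
    fix w assume w: "w \<in> polydisc N u s"
    have "dist (c n) (w n) < R" if n: "n \<le> N - 2" for n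
    proof -
      have "dist (u n) (w n) < s" using w n by (simp add: polydisc_def)
      then show ?thesis using le[OF n] dist_triangle[of "c n" "w n" "u n"] by linarith
    qed
    then show "w \<in> polydisc N c R" by (simp add: polydisc_def)
  qed
qed

definition slice_radius :: "nat \<Rightarrow> real \<Rightarrow> real" where
  "slice_radius N v = min (v / 4) (moduli_radius N * v / 2)"

definition SW_domain :: "nat \<Rightarrow> (nat \<Rightarrow> complex) set" where
  "SW_domain N = {u. 0 < Re (1 - u 0) \<and> cmod (1 - u 0) < 4 / 3 \<and> small_moduli N (AD_coords N u)}"

lemma not_nonpos_Reals_times_two_minus:
  assumes "0 < Re v" "Re v < 2"
  shows "v * (2 - v) \<notin> \<real>\<^sub>\<le>\<^sub>0"
proof
  assume "v * (2 - v) \<in> \<real>\<^sub>\<le>\<^sub>0"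
  then have im: "Im v * (1 - Re v) = 0" and re: "Re v * (2 - Re v) + Im v * Im v \<le> 0"
    by (auto simp: complex_nonpos_Reals_iff algebra_simps)
  have "Re v * (2 - Re v) > 0" using assms by simp
  moreover have "Im v * Im v \<ge> 0" by simp
  ultimately show False using re by linarith
qed

context
  fixes N :: nat and \<zeta> :: complex
  assumes N: "3 \<le> N" and \<zeta>: "\<zeta> ^ N = -1"
begin

lemma AD_period_holomorphic:
  fixes v :: "complex \<Rightarrow> complex" and c :: "complex \<Rightarrow> nat \<Rightarrow> complex"
  assumes U: "open U"
    and v: "v holomorphic_on U" "\<And>x. x \<in> U \<Longrightarrow> 0 < Re (v x)" "\<And>x. x \<in> U \<Longrightarrow> cmod (v x) < 4 / 3"
    and c: "\<And>n. n \<in> {1..N - 2} \<Longrightarrow> (\<lambda>x. c x n) holomorphic_on U" "\<And>x. x \<in> U \<Longrightarrow> small_moduli N (c x)"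
  shows "(\<lambda>x. AD_period N \<zeta> (v x) (c x)) holomorphic_on U"
proof -
  have one_le_N: "N \<ge> 1" using N by simp
  have root: "(\<lambda>x. AD_root N \<zeta> (c x)) holomorphic_on U"
    by (rule AD_root_holomorphic[OF N \<zeta> U c])
  have per: "(\<lambda>x. period N (v x) (root_coeffs N \<zeta> (c x))) holomorphic_on U"
  proof (rule period_holomorphic[OF U one_le_N v(1,3)])
    fix n assume "n \<in> {1..N - 2}"
    then show "(\<lambda>x. root_coeffs N \<zeta> (c x) n) holomorphic_on U"
      unfolding root_coeffs_def by (intro holomorphic_intros c root)
  qed (use small_root_coeffs[OF N \<zeta> c(2)] in auto)
  have R: "Re (v x) < 2" if "x \<in> U" for x
    using v(3)[OF that] complex_Re_le_cmod[of "v x"] by linarith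
  have v1: "v x \<notin> \<real>\<^sub>\<le>\<^sub>0" if "x \<in> U" for x by (rule not_nonpos_Reals_if_Re_pos[OF v(2)[OF that]])
  have v2: "2 - v x \<notin> \<real>\<^sub>\<le>\<^sub>0" if "x \<in> U" for x
    by (rule not_nonpos_Reals_if_Re_pos) (use R[OF that] in simp)
  have v3: "v x * (2 - v x) \<notin> \<real>\<^sub>\<le>\<^sub>0" if "x \<in> U" for x
    by (rule not_nonpos_Reals_times_two_minus[OF v(2)[OF that] R[OF that]])
  have nz: "of_real pi * csqrt (v x * (2 - v x)) \<noteq> 0" if "x \<in> U" for x
  proof -
    have "v x \<noteq> 0" "2 - v x \<noteq> 0" using v1[OF that] v2[OF that] by force+
    then show ?thesis by simp
  qed
  show ?thesis
    unfolding AD_period_def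
    by (intro holomorphic_intros root per v(1)) (use v1 v2 v3 nz in auto)
qed

lemma AD_period_bounded:
  obtains B where "\<And>v w. v \<noteq> 0 \<Longrightarrow> cmod v < 4 / 3 \<Longrightarrow> small_moduli N w \<Longrightarrow> cmod (AD_period N \<zeta> v w) \<le> B"
proof
  fix v :: complex and w
  assume v: "v \<noteq> 0" "cmod v < 4 / 3" and w: "small_moduli N w"
  define C where "C = 2 * (8 * (real N ^ 2 * 2 ^ N)) / (sqrt (1 / 2) * sqrt (1 / 12))"
  define p where "p = cmod (period N v (root_coeffs N \<zeta> w))"
  have p: "p \<le> C" "0 \<le> p"
    unfolding p_def C_def using N by (intro cmod_period_le small_root_coeffs[OF N \<zeta> w] v) auto
  have "cmod (v powr (1 / of_nat N)) = cmod v powr (1 / real N)"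
    using norm_powr_real_powr'[of "1 / of_nat N" v] by simp
  also have "\<dots> \<le> 2 powr (1 / real N)" using v by (intro powr_mono2) auto
  also have "\<dots> \<le> 2 powr 1" using N by (intro powr_mono) auto
  finally have k: "cmod (v powr (1 / of_nat N)) \<le> 2" by simp
  have b: "cmod (AD_root N \<zeta> w) \<le> 2" by (rule cmod_near_zeta(2)[OF N \<zeta> AD_root_props(1)[OF N \<zeta> w]])
  have v2: "2 - v \<noteq> 0" using v by auto
  have "cmod v * sqrt (cmod (2 - v)) / (pi * sqrt (cmod (v * (2 - v)))) = sqrt (cmod v) / pi"
  proof -
    have eq: "sqrt (cmod (v * (2 - v))) = sqrt (cmod v) * sqrt (cmod (2 - v))"
      by (simp only: norm_mult real_sqrt_mult)
    have sq: "sqrt (cmod v) * sqrt (cmod v) = cmod v" by simp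
    have "a * a * m / (pi * (a * m)) = a / pi" if "a \<noteq> 0" "m \<noteq> 0" for a m :: real
      using that by simp
    from this[of "sqrt (cmod v)" "sqrt (cmod (2 - v))"] show ?thesis
      using v v2 unfolding sq eq by simp
  qed
  also have "\<dots> \<le> 2 / 1"
    using v pi_gt3 by (intro frac_le) (auto intro: real_le_lsqrt)
  finally have s: "cmod v * sqrt (cmod (2 - v)) / (pi * sqrt (cmod (v * (2 - v)))) \<le> 2" by simp
  have "cmod (AD_period N \<zeta> v w) =
      2 * (cmod (v powr (1 / of_nat N)) * cmod (AD_root N \<zeta> w)) *
      (cmod v * sqrt (cmod (2 - v)) / (pi * sqrt (cmod (v * (2 - v))))) * p"
    unfolding AD_period_def p_def by (simp add: norm_mult norm_divide norm_csqrt)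
  also have "\<dots> \<le> 2 * (2 * 2) * 2 * C"
    using k b s p by (intro mult_mono) auto
  finally show "cmod (AD_period N \<zeta> v w) \<le>
      2 * (2 * 2) * 2 * (2 * (8 * (real N ^ 2 * 2 ^ N)) / (sqrt (1 / 2) * sqrt (1 / 12)))"
    by (simp only: C_def)
qed

lemma SW_period_differentiable:
  assumes s: "s > 0" "polydisc N u s \<subseteq> SW_domain N"
  shows "\<exists>D. \<forall>e>0. \<exists>d>0. \<forall>w\<in>polydisc N u d.
    cmod (SW_period N \<zeta> w - SW_period N \<zeta> u - (\<Sum>n\<le>N - 2. D n * (w n - u n)))
      \<le> e * (\<Sum>n\<le>N - 2. cmod (w n - u n))"
proof -
  obtain B where B: "\<And>v w. v \<noteq> 0 \<Longrightarrow> cmod v < 4 / 3 \<Longrightarrow> small_moduli N w \<Longrightarrow> cmod (AD_period N \<zeta> v w) \<le> B"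
    using AD_period_bounded by blast
  define r where "r = s / 2"
  have r: "0 < r" "2 * r = s" using s by (auto simp: r_def)
  show ?thesis
  proof (rule separately_holomorphic_differentiable[OF r(1), unfolded r(2)])
    fix w n assume w: "w \<in> polydisc N u s" and n: "n \<le> N - 2"
    have dom: "w(n := x) \<in> SW_domain N" if "x \<in> ball (u n) s" for x
      using polydisc_upd[OF w that] s(2) by blast
    have co: "(\<lambda>x. (w(n := x)) m) holomorphic_on A" for m A
      by (cases "m = n") (auto intro: holomorphic_intros)
    show "(\<lambda>x. SW_period N \<zeta> (w(n := x))) holomorphic_on ball (u n) s"
      unfolding SW_period_def
    proof (rule AD_period_holomorphic)
      show "(\<lambda>x. 1 - (w(n := x)) 0) holomorphic_on ball (u n) s"
        by (intro holomorphic_intros co)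
      fix m
      have "1 - (w(n := x)) 0 \<notin> \<real>\<^sub>\<le>\<^sub>0" if "x \<in> ball (u n) s" for x
        using dom[OF that] by (intro not_nonpos_Reals_if_Re_pos) (simp only: SW_domain_def mem_Collect_eq)
      moreover from this have "1 - (w(n := x)) 0 \<noteq> 0" if "x \<in> ball (u n) s" for x
        using that by force
      ultimately show "(\<lambda>x. AD_coords N (w(n := x)) m) holomorphic_on ball (u n) s"
        unfolding AD_coords_def
        by (intro holomorphic_intros co) (auto simp del: fun_upd_apply)
    qed (use dom in \<open>auto simp: SW_domain_def simp del: fun_upd_apply\<close>)
  next
    fix w assume "w \<in> polydisc N u s"
    then have "w \<in> SW_domain N" using s by blast
    then show "cmod (SW_period N \<zeta> w) \<le> B"
      unfolding SW_period_def SW_domain_def by (intro B) auto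
  next
    fix w w' :: "nat \<Rightarrow> complex" assume "\<And>n. n \<le> N - 2 \<Longrightarrow> w n = w' n"
    then show "SW_period N \<zeta> w = SW_period N \<zeta> w'" by (rule SW_period_cong)
  qed
qed

lemma slice_radius_pos: "0 < v \<Longrightarrow> 0 < slice_radius N v"
  using moduli_radius_pos[OF N \<zeta>] by (simp add: slice_radius_def)

lemma polydisc_real_slice_subset:
  assumes v: "v \<in> {0<..1}"
  shows "polydisc N (real_slice v) (slice_radius N v) \<subseteq> SW_domain N"
proof
  fix u assume u: "u \<in> polydisc N (real_slice v) (slice_radius N v)"
  define v' where "v' = 1 - u 0"
  have "dist (of_real (1 - v)) (u 0) < v / 4"
    using u by (force simp: polydisc_def slice_radius_def)
  also have "dist (of_real (1 - v)) (u 0) = cmod (v' - of_real v)"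
    by (simp add: dist_norm v'_def algebra_simps)
  finally have d: "cmod (v' - of_real v) < v / 4" .
  have re: "0 < Re v'" using d abs_Re_le_cmod[of "v' - of_real v"] v by auto
  have up: "cmod v' < 4 / 3" using d norm_triangle_ineq2[of v' "of_real v"] v by auto
  have lo: "3 * v / 4 \<le> cmod v'" using d norm_triangle_ineq2[of "of_real v" v'] v by (auto simp: norm_minus_commute)
  have "cmod (AD_coords N u n) < moduli_radius N" if n: "n \<in> {1..N - 2}" for n
  proof -
    have "cmod (u n) < moduli_radius N * v / 2"
      using u n by (force simp: polydisc_def slice_radius_def)
    also have "\<dots> \<le> moduli_radius N * (3 * v / 4)" using moduli_radius_pos[OF N \<zeta>] v by simp
    also have "\<dots> \<le> moduli_radius N * cmod (v' powr (1 - of_nat n / of_nat N))"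
      using moduli_radius_pos[OF N \<zeta>] n v lo by (intro mult_left_mono cmod_powr_ge) auto
    finally have "cmod (u n) < moduli_radius N * cmod (v' powr (1 - of_nat n / of_nat N))" .
    moreover have "v' \<noteq> 0" using re by auto
    ultimately show ?thesis
      by (simp add: AD_coords_def v'_def[symmetric] norm_divide divide_less_eq)
  qed
  then show "u \<in> SW_domain N"
    using re up by (simp add: SW_domain_def small_moduli_def v'_def)
qed

lemma is_continuation_period: "is_continuation N (SW_period N \<zeta>) (AD_period N \<zeta>)"
  unfolding is_continuation_def
proof (intro exI conjI)
  show "\<forall>v\<in>{0<..1}. 0 < slice_radius N v" using slice_radius_pos by simp
  show "moduli_holomorphic_on N (SW_period N \<zeta>) (\<Union>v\<in>{0<..1}. polydisc N (real_slice v) (slice_radius N v))"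
    unfolding moduli_holomorphic_on_def
  proof
    fix u assume "u \<in> (\<Union>v\<in>{0<..1}. polydisc N (real_slice v) (slice_radius N v))"
    then obtain v where v: "v \<in> {0<..1}" "u \<in> polydisc N (real_slice v) (slice_radius N v)" by blast
    then obtain s where "s > 0" "polydisc N u s \<subseteq> polydisc N (real_slice v) (slice_radius N v)"
      using polydisc_open by blast
    then have "s > 0" "polydisc N u s \<subseteq> SW_domain N"
      using polydisc_real_slice_subset[OF v(1)] by auto
    from SW_period_differentiable[OF this]
    show "\<exists>D. \<forall>e>0. \<exists>d>0. \<forall>w\<in>(\<Union>v\<in>{0<..1}. polydisc N (real_slice v) (slice_radius N v)) \<inter> polydisc N u d.
        cmod (SW_period N \<zeta> w - SW_period N \<zeta> u - (\<Sum>n\<le>N - 2. D n * (w n - u n)))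
          \<le> e * (\<Sum>n\<le>N - 2. cmod (w n - u n))"
      by (meson IntD2)
  qed
  show "\<forall>u\<in>polydisc N (real_slice 1) (slice_radius N 1). SW_period N \<zeta> u = SW_period N \<zeta> u" by simp
  show "\<exists>\<epsilon>\<in>{0<..1}. \<forall>v\<in>{0<..<\<epsilon>}. \<forall>v' w.
      AD_moduli N v' w \<in> polydisc N (real_slice v) (slice_radius N v) \<longrightarrow>
      SW_period N \<zeta> (AD_moduli N v' w) = AD_period N \<zeta> v' w"
  proof (intro bexI[of _ 1] ballI allI impI)
    fix v :: real and v' w
    assume "v \<in> {0<..<1}" and m: "AD_moduli N v' w \<in> polydisc N (real_slice v) (slice_radius N v)"
    then have "AD_moduli N v' w \<in> SW_domain N" using polydisc_real_slice_subset[of v] by auto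
    then have "v' \<noteq> 0" by (auto simp: SW_domain_def AD_moduli_def)
    then show "SW_period N \<zeta> (AD_moduli N v' w) = AD_period N \<zeta> v' w" by (rule SW_period_AD_moduli)
  qed simp
qed

end

theorem corollary2p3:
  fixes N :: nat and \<zeta> :: complex
  assumes "3 \<le> N" and "\<zeta> ^ N = -1"
  shows "\<exists>Q R. is_Q N \<zeta> Q \<and> is_R N \<zeta> R \<and> is_continuation N Q R"
  using is_Q_SW_period[OF assms] is_R_AD_period[OF assms] is_continuation_period[OF assms] by blast

end
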